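(* There exists a computable constant $C_3=C_3(m,n)$ such that $\operatorname{Per}\Psi=\operatorname{Fix}\Psi^{C_3}$ for every endomorphism $\Psi\in\operatorname{End}(\mathbb{Z}^m\times F_n)$.
   Context: Here $m,n\geqslant 0$ are integers, $F_n$ denotes the free group of rank $n$, and $\mathbb{Z}^m\times F_n$ is the direct product of groups. For an endomorphism $\Psi$ of a group $G$, $\operatorname{Fix}\Psi=\{g\in G\mid g\Psi=g\}$ is its fixed subgroup (maps are written on the right of their arguments), $\Psi^p$ is the $p$-fold composition of $\Psi$, and $\operatorname{Per}\Psi=\bigcup_{p=1}^{\infty}\operatorname{Fix}\Psi^p$ is its periodic subgroup. "Computable constant $C_3(m,n)$" means that the constant is a positive integer depending only on $m$ and $n$ (not on $\Psi$), and that the function $(m,n)\mapsto C_3(m,n)$ is computable. *)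

theory Defs
  imports "HOL-Algebra.Algebra"
begin

section \<open>Free groups\<close>

text \<open>
  The free group on a set \<open>S\<close> consists of the reduced words over \<open>S\<close>. The letter \<open>(x, True)\<close>
  stands for the generator \<open>x\<close> and \<open>(x, False)\<close> for its inverse.
\<close>

definition inv_letter :: "'a \<times> bool \<Rightarrow> 'a \<times> bool" where
  "inv_letter a = (fst a, \<not> snd a)"

definition reduced :: "('a \<times> bool) list \<Rightarrow> bool" where
  "reduced w \<longleftrightarrow> successively (\<lambda>a b. b \<noteq> inv_letter a) w"

fun cancel_cons :: "'a \<times> bool \<Rightarrow> ('a \<times> bool) list \<Rightarrow> ('a \<times> bool) list" where
  "cancel_cons a [] = [a]"
| "cancel_cons a (b # w) = (if b = inv_letter a then w else a # b # w)"

definition free_group :: "'a set \<Rightarrow> ('a \<times> bool) list monoid" where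
  "free_group S = \<lparr>carrier = {w. reduced w \<and> fst ` set w \<subseteq> S},
                   monoid.mult = foldr cancel_cons,
                   one = []\<rparr>"

lemma inv_letter_inv_letter [simp]: "inv_letter (inv_letter a) = a"
  by (simp add: inv_letter_def)

lemma fst_inv_letter [simp]: "fst (inv_letter a) = fst a"
  by (simp add: inv_letter_def)

lemma inv_letter_neq [simp]: "inv_letter a \<noteq> a" "a \<noteq> inv_letter a"
  by (auto simp: inv_letter_def prod_eq_iff)

lemma reduced_Nil [simp]: "reduced []"
  by (simp add: reduced_def)

lemma reduced_tl: "reduced (a # w) \<Longrightarrow> reduced w"
  by (cases w) (auto simp: reduced_def)

lemma reduced_cancel_cons: "reduced w \<Longrightarrow> reduced (cancel_cons a w)"
  by (cases w) (auto simp: reduced_def dest: reduced_tl[unfolded reduced_def])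

lemma cancel_cons_reduced: "reduced (a # w) \<Longrightarrow> cancel_cons a w = a # w"
  by (cases w) (auto simp: reduced_def)

lemma cancel_cons_inverse:
  assumes "reduced w"
  shows "cancel_cons (inv_letter a) (cancel_cons a w) = w"
proof (cases w)
  case (Cons b v)
  then show ?thesis
    using assms by (cases "b = inv_letter a") (auto simp: cancel_cons_reduced)
qed simp

lemma cancel_cons_inverse':
  "reduced w \<Longrightarrow> cancel_cons a (cancel_cons (inv_letter a) w) = w"
  using cancel_cons_inverse[of w "inv_letter a"] by simp

lemma reduced_foldr: "reduced w \<Longrightarrow> reduced (foldr cancel_cons u w)"
  by (induction u) (auto simp: reduced_cancel_cons)

lemma foldr_cancel_cons_Nil: "reduced w \<Longrightarrow> foldr cancel_cons w [] = w"
proof (induction w)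
  case (Cons a w)
  then show ?case
    using cancel_cons_reduced[of a w] reduced_tl[of a w] by simp
qed simp

lemma letters_cancel_cons: "set (cancel_cons a w) \<subseteq> insert a (set w)"
  by (cases w) auto

lemma letters_foldr: "set (foldr cancel_cons u w) \<subseteq> set u \<union> set w"
proof (induction u)
  case (Cons a u)
  then show ?case
    using letters_cancel_cons[of a "foldr cancel_cons u w"] by auto
qed simp

lemma foldr_cancel_cons_step:
  assumes "reduced w"
  shows "foldr cancel_cons (cancel_cons a x) w = cancel_cons a (foldr cancel_cons x w)"
proof (cases x)
  case (Cons b y)
  then show ?thesis
    by (auto simp: cancel_cons_inverse' reduced_foldr assms)
qed simp

lemma foldr_cancel_cons_assoc:
  "reduced w \<Longrightarrow>
    foldr cancel_cons (foldr cancel_cons u v) w = foldr cancel_cons u (foldr cancel_cons v w)"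
  by (induction u) (auto simp: foldr_cancel_cons_step)

lemma foldr_cancel_cons_rev:
  "reduced w \<Longrightarrow>
    foldr cancel_cons (rev (map inv_letter u)) (foldr cancel_cons u w) = w"
  by (induction u) (auto simp: cancel_cons_inverse reduced_foldr)

lemma group_free_group: "Group.group (free_group S)"
proof (rule groupI)
  fix u assume u: "u \<in> carrier (free_group S)"
  define v where "v = foldr cancel_cons (rev (map inv_letter u)) []"
  have "fst ` set v \<subseteq> fst ` set u"
  proof
    fix x assume "x \<in> fst ` set v"
    then obtain a where "a \<in> set v" "x = fst a" by blast
    then obtain b where "b \<in> set u" "a = inv_letter b"
      using letters_foldr[of "rev (map inv_letter u)" "[]"] unfolding v_def by auto
    with \<open>x = fst a\<close> show "x \<in> fst ` set u" by simp
  qed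
  then have "v \<in> carrier (free_group S)"
    using u by (auto simp: free_group_def v_def reduced_foldr)
  moreover have "foldr cancel_cons v u = []"
  proof -
    have "u = foldr cancel_cons u []" "reduced u"
      using u by (simp_all add: free_group_def foldr_cancel_cons_Nil)
    then show ?thesis
      using foldr_cancel_cons_assoc[of u "rev (map inv_letter u)" "[]"]
        foldr_cancel_cons_rev[of "[]" u] unfolding v_def by simp
  qed
  ultimately show "\<exists>v \<in> carrier (free_group S). v \<otimes>\<^bsub>free_group S\<^esub> u = \<one>\<^bsub>free_group S\<^esub>"
    by (auto simp: free_group_def)
next
  fix u v assume "u \<in> carrier (free_group S)" "v \<in> carrier (free_group S)"
  then show "u \<otimes>\<^bsub>free_group S\<^esub> v \<in> carrier (free_group S)"
    using letters_foldr[of u v] by (fastforce simp: free_group_def reduced_foldr)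
qed (auto simp: free_group_def foldr_cancel_cons_assoc)

definition free_group_gen :: "'a \<Rightarrow> ('a \<times> bool) list" where
  "free_group_gen x = [(x, True)]"

lemma free_group_gen_closed: "x \<in> S \<Longrightarrow> free_group_gen x \<in> carrier (free_group S)"
  by (simp add: free_group_gen_def free_group_def reduced_def)

definition letter_val :: "('b, 'c) monoid_scheme \<Rightarrow> ('a \<Rightarrow> 'b) \<Rightarrow> 'a \<times> bool \<Rightarrow> 'b" where
  "letter_val H f a = (if snd a then f (fst a) else inv\<^bsub>H\<^esub> f (fst a))"

definition word_val :: "('b, 'c) monoid_scheme \<Rightarrow> ('a \<Rightarrow> 'b) \<Rightarrow> ('a \<times> bool) list \<Rightarrow> 'b" where
  "word_val H f w = foldr (\<lambda>a y. letter_val H f a \<otimes>\<^bsub>H\<^esub> y) w \<one>\<^bsub>H\<^esub>"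

lemma word_val_simps [simp]:
  "word_val H f [] = \<one>\<^bsub>H\<^esub>"
  "word_val H f (a # w) = letter_val H f a \<otimes>\<^bsub>H\<^esub> word_val H f w"
  by (simp_all add: word_val_def)

theorem free_group_universal:
  assumes "Group.group H" and f: "f \<in> S \<rightarrow> carrier H"
  shows "\<exists>h \<in> hom (free_group S) H. \<forall>x\<in>S. h (free_group_gen x) = f x"
    and "\<lbrakk>h \<in> hom (free_group S) H; h' \<in> hom (free_group S) H;
          \<forall>x\<in>S. h (free_group_gen x) = h' (free_group_gen x); w \<in> carrier (free_group S)\<rbrakk>
         \<Longrightarrow> h w = h' w"
proof -
  interpret H: Group.group H by fact
  have letter: "letter_val H f a \<in> carrier H" if "fst a \<in> S" for a
    using that f by (auto simp: letter_val_def)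
  have word: "word_val H f w \<in> carrier H" if "fst ` set w \<subseteq> S" for w
    using that by (induction w) (auto simp: letter)
  have letter_inv: "letter_val H f (inv_letter a) = inv\<^bsub>H\<^esub> letter_val H f a" if "fst a \<in> S" for a
  proof -
    have "f (fst a) \<in> carrier H" using that f by auto
    then show ?thesis by (simp add: letter_val_def inv_letter_def)
  qed
  have step: "word_val H f (cancel_cons a w) = letter_val H f a \<otimes>\<^bsub>H\<^esub> word_val H f w"
    if "fst a \<in> S" "fst ` set w \<subseteq> S" for a w
  proof (cases w)
    case (Cons b v)
    then show ?thesis
      using that letter[of a] word[of v] by (auto simp: letter_inv H.m_assoc[symmetric])
  qed simp
  have mult: "word_val H f (foldr cancel_cons u w) = word_val H f u \<otimes>\<^bsub>H\<^esub> word_val H f w"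
    if "fst ` set u \<subseteq> S" "fst ` set w \<subseteq> S" for u w
    using that(1)
  proof (induction u)
    case Nil
    then show ?case using word[OF that(2)] by simp
  next
    case (Cons a u)
    have "fst ` set (foldr cancel_cons u w) \<subseteq> S"
      using letters_foldr[of u w] Cons.prems that(2) by fastforce
    then show ?case
      using Cons letter[of a] word[of u] word[OF that(2)] by (simp add: step H.m_assoc)
  qed
  show "\<exists>h \<in> hom (free_group S) H. \<forall>x\<in>S. h (free_group_gen x) = f x"
  proof
    show "word_val H f \<in> hom (free_group S) H"
      by (auto simp: hom_def free_group_def word mult)
    show "\<forall>x\<in>S. word_val H f (free_group_gen x) = f x"
      using f by (auto simp: free_group_gen_def letter_val_def Pi_iff)
  qed
next
  assume h: "h \<in> hom (free_group S) H" and h': "h' \<in> hom (free_group S) H"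
    and eq: "\<forall>x\<in>S. h (free_group_gen x) = h' (free_group_gen x)"
    and w: "w \<in> carrier (free_group S)"
  interpret F: Group.group "free_group S" by (rule group_free_group)
  interpret H: Group.group H by fact
  interpret h: group_hom "free_group S" H h by unfold_locales (fact h)
  interpret h': group_hom "free_group S" H h' by unfold_locales (fact h')
  have letter: "h [a] = h' [a]" if "fst a \<in> S" for a
  proof (cases "snd a")
    case True
    then have "[a] = free_group_gen (fst a)"
      by (simp add: free_group_gen_def prod_eq_iff)
    then show ?thesis using eq that by simp
  next
    case False
    then have a: "a = (fst a, False)" by (simp add: prod_eq_iff)
    have "[a] = inv\<^bsub>free_group S\<^esub> free_group_gen (fst a)"
      by (rule F.inv_equality[symmetric])
        (use that in \<open>subst a; simp add: free_group_def free_group_gen_def inv_letter_def reduced_def\<close>)+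
    then show ?thesis
      using eq that free_group_gen_closed[OF that] by simp
  qed
  show "h w = h' w"
    using w
  proof (induction w)
    case Nil
    have "[] = \<one>\<^bsub>free_group S\<^esub>" by (simp add: free_group_def)
    then show ?case using h.hom_one h'.hom_one by metis
  next
    case (Cons a w)
    have w: "w \<in> carrier (free_group S)" and a: "[a] \<in> carrier (free_group S)" "fst a \<in> S"
      using Cons.prems reduced_tl[of a w] by (auto simp: free_group_def reduced_def)
    have "a # w = [a] \<otimes>\<^bsub>free_group S\<^esub> w"
      using Cons.prems cancel_cons_reduced[of a w] by (simp add: free_group_def)
    then show ?case
      using Cons.IH[OF w] letter[OF a(2)] a(1) w by simp
  qed
qed


section \<open>The group \<open>\<int>\<^sup>m \<times> F\<^sub>n\<close>\<close>

definition int_power_group :: "nat \<Rightarrow> (nat \<Rightarrow> int) monoid" where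
  "int_power_group m = product_group {..<m} (\<lambda>_. integer_group)"

definition free_times_free_abelian :: "nat \<Rightarrow> nat \<Rightarrow> ((nat \<Rightarrow> int) \<times> (nat \<times> bool) list) monoid" where
  "free_times_free_abelian m n = int_power_group m \<times>\<times> free_group {..<n}"

lemma group_free_times_free_abelian: "Group.group (free_times_free_abelian m n)"
  unfolding free_times_free_abelian_def int_power_group_def
  by (intro DirProd_group group_free_group) simp


section \<open>Fixed and periodic points\<close>

definition Fix :: "('a, 'b) monoid_scheme \<Rightarrow> ('a \<Rightarrow> 'a) \<Rightarrow> 'a set" where
  "Fix G \<Psi> = {g \<in> carrier G. \<Psi> g = g}"

definition Per :: "('a, 'b) monoid_scheme \<Rightarrow> ('a \<Rightarrow> 'a) \<Rightarrow> 'a set" where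
  "Per G \<Psi> = (\<Union>p\<in>{1..}. Fix G (\<Psi> ^^ p))"


section \<open>Computable functions\<close>

text \<open>
  Total computable functions are rendered as Kleene's general recursive functions:
  \<open>recursive k f\<close> says that \<open>f\<close> is one of arity \<open>k\<close>. Argument tuples are lists; the values of \<open>f\<close>
  on lists whose length is not \<open>k\<close> are irrelevant. Minimization is only applied to regular
  functions, so that the result is total.
\<close>

inductive recursive :: "nat \<Rightarrow> (nat list \<Rightarrow> nat) \<Rightarrow> bool" where
  zero: "recursive k (\<lambda>_. 0)"
| succ: "recursive 1 (\<lambda>xs. Suc (xs ! 0))"
| proj: "i < k \<Longrightarrow> recursive k (\<lambda>xs. xs ! i)"
| comp: "\<lbrakk>recursive (length gs) f; \<forall>g \<in> set gs. recursive k g\<rbrakk>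
         \<Longrightarrow> recursive k (\<lambda>xs. f (map (\<lambda>g. g xs) gs))"
| prim_rec: "\<lbrakk>recursive k f; recursive (Suc (Suc k)) g\<rbrakk>
         \<Longrightarrow> recursive (Suc k)
               (\<lambda>xs. rec_nat (f (tl xs)) (\<lambda>y r. g (y # r # tl xs)) (hd xs))"
| minim: "\<lbrakk>recursive (Suc k) f; \<forall>xs. length xs = k \<longrightarrow> (\<exists>y. f (y # xs) = 0)\<rbrakk>
         \<Longrightarrow> recursive k (\<lambda>xs. LEAST y. f (y # xs) = 0)"

definition computable2 :: "(nat \<Rightarrow> nat \<Rightarrow> nat) \<Rightarrow> bool" where
  "computable2 C \<longleftrightarrow> (\<exists>f. recursive 2 f \<and> (\<forall>m n. C m n = f [m, n]))"

end

theory Submission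
  imports Defs
begin

text \<open>
  Periodic points of an endomorphism \<open>\<Psi>\<close> of \<open>\<int>\<^sup>m \<times> F\<^sub>n\<close> have uniformly bounded period because they
  are detected by lattices on which \<open>\<Psi>\<close> acts through tensor powers of integer matrices of size at most
  \<open>N = m + n\<close>, and for such actions an argument of Minkowski bounds the periods. The exponent is
  \<open>s!\<close> with \<open>s = 4\<^bsup>N N\<^esup>\<close>.

  The number of \<open>N \<times> N\<close> matrices modulo 4 is \<open>s\<close>, so by the pigeonhole principle the \<open>s!\<close>-th power of
  every such matrix over the integers is idempotent modulo 4, and so are the tensor powers of that power
  (\<open>mod4_idempotent_tensor_power\<close>). An endomorphism \<open>T\<close> of a lattice that is idempotent modulo 4 fixes all
  of its periodic points (\<open>periodic_imp_fixed\<close>): it is invertible on the periodic points of a given period,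
  hence congruent to the identity modulo 4 there, and an operator of finite order that is congruent to
  the identity modulo 4 is the identity. Consequently a vector with a vanishing orbit sum
  \<open>f + T f + \<dots> + T\<^bsup>p-1\<^esup> f\<close> is zero (\<open>orbit_sum_zero\<close>).

  The free group embeds into the units of the ring of power series in non-commuting variables by
  \<open>x\<^sub>i \<mapsto> 1 + X\<^sub>i\<close> (\<open>magnus_faithful\<close>), and an endomorphism acts on expansions by substitution
  (\<open>magnus_endomorphism\<close>). If the expansion of \<open>h\<close> is \<open>1\<close> plus terms of degree at least \<open>k\<close>, then its
  terms of degree \<open>k\<close> are transformed by the \<open>k\<close>-th tensor power of the matrix of the endomorphism on the
  abelianization (\<open>endomorphism_leading_form\<close>). Let \<open>\<psi>\<close> be the \<open>s!\<close>-th power of the endomorphism. If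
  \<open>h \<cdot> \<psi> h \<cdots> \<psi>\<^bsup>p-1\<^esup> h = 1\<close>, then the leading terms of \<open>h\<close> have a vanishing orbit sum and hence are
  zero, in all degrees successively; so \<open>h = 1\<close> (\<open>twisted_orbit_product_trivial\<close>).

  For a periodic point \<open>x\<close> of \<open>\<int>\<^sup>m \<times> F\<^sub>n\<close> the same principle, applied to the abelianization, shows that
  \<open>\<psi> x = x h\<close> with \<open>h\<close> in the commutator subgroup, which lies in the free factor. Expanding \<open>\<psi>\<^bsup>p\<^esup> x = x\<close>
  gives a trivial product as above, so \<open>h = 1\<close> and \<open>x\<close> is fixed by \<open>\<psi>\<close> (\<open>periodic_point_fixed\<close>).
\<close>

section \<open>Operators that are idempotent modulo 4\<close>

lemma funpow_additive:
  fixes T :: "'v::plus \<Rightarrow> 'v"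
  assumes "\<And>x y. T (x + y) = T x + T y"
  shows "(T ^^ i) (x + y) = (T ^^ i) x + (T ^^ i) y"
  by (induction i) (auto simp: assms)

text \<open>
  The operators below act on torsion-free groups without nonzero infinitely 2-divisible elements.
  The modulus is 4 rather than 2 because \<open>-1\<close> has order 2 and is congruent to \<open>1\<close> modulo 2; modulo 4
  a nontrivial operator of finite order is never congruent to the identity (Minkowski). The ring
  structure only serves to multiply by integers.
\<close>

locale mod4_idempotent =
  fixes T :: "'v::ring_1 \<Rightarrow> 'v"
  assumes T_add: "T (x + y) = T x + T y"
    and T_idem: "\<exists>y. T (T x) - T x = 4 * y"
    and torsion_free: "q > 0 \<Longrightarrow> of_nat q * x = 0 \<Longrightarrow> x = 0"
    and separated: "(\<And>k. \<exists>y. x = 2 ^ k * y) \<Longrightarrow> x = 0"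
begin

lemma iter_add: "(T ^^ i) (x + y) = (T ^^ i) x + (T ^^ i) y" for x y :: 'v
  by (rule funpow_additive) (rule T_add)

lemma iter_diff: "(T ^^ i) (x - y) = (T ^^ i) x - (T ^^ i) y" for x y :: 'v
  using iter_add[of i "x - y" y] by simp

lemma iter_zero: "(T ^^ i) 0 = 0"
  using iter_diff[of i 0 0] by simp

lemma T_sum: "T (\<Sum>i<k. g i) = (\<Sum>i<k. T (g i))" for g :: "nat \<Rightarrow> 'v"
  using iter_zero[of 1] by (induction k) (simp_all add: T_add)

lemma iter_of_nat: "(T ^^ i) (of_nat k * x) = of_nat k * (T ^^ i) x" for x :: 'v
  by (induction k) (auto simp: iter_zero iter_add distrib_right)

lemma iter_double: "(T ^^ i) (2 * x) = 2 * (T ^^ i) x" for x :: 'v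
  using iter_of_nat[of i 2 x] by simp

lemma iter_quadruple: "(T ^^ i) (4 * x) = 4 * (T ^^ i) x" for x :: 'v
  using iter_of_nat[of i 4 x] by simp

lemma cancel_scalar: "q > 0 \<Longrightarrow> of_nat q * x = of_nat q * y \<Longrightarrow> x = y" for x y :: 'v
  using torsion_free[of q "x - y"] by (simp add: right_diff_distrib)

lemma cancel_2: "2 * x = 2 * y \<Longrightarrow> x = y" for x y :: 'v
  using cancel_scalar[of 2 x y] by simp

lemma cancel_4: "4 * x = 4 * y \<Longrightarrow> x = y" for x y :: 'v
  using cancel_scalar[of 4 x y] by simp

text \<open>
  On the set of points of period \<open>p\<close> the operator \<open>T\<close> is invertible, and an invertible idempotent is the
  identity. So \<open>T\<close> is the identity modulo 4 there. The quotient by 4 can be taken inside this set,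
  because \<open>4 (T\<^sup>p y - y) = 0\<close> forces \<open>T\<^sup>p y = y\<close>; this is why \<open>z\<close> is again a point of period \<open>p\<close>.
\<close>

lemma iter_one_mod_4:
  assumes p: "p > 0" and w: "(T ^^ p) w = w"
  shows "\<exists>z. (T ^^ p) z = z \<and> (T ^^ i) w = w + 4 * z"
proof (induction i)
  case 0
  show ?case by (rule exI[of _ 0]) (simp add: iter_zero)
next
  case (Suc i)
  then obtain z where z: "(T ^^ p) z = z" "(T ^^ i) w = w + 4 * z" by blast
  define w' where "w' = (T ^^ i) w"
  have w': "(T ^^ p) w' = w'"
    unfolding w'_def using w by (metis add.commute funpow_add o_apply)
  obtain y where y: "T (T w') - T w' = 4 * y" using T_idem by blast
  define u where "u = T w' - w'"
  obtain p' where p': "p = Suc p'" using p by (cases p) auto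
  have up: "(T ^^ p) u = u"
    unfolding u_def iter_diff w'
    using w' by (metis funpow_swap1)
  \<comment> \<open>Divisibility of \<open>T u\<close> by 4 passes to \<open>u\<close>, since \<open>u\<close> is the image of \<open>T u\<close> under \<open>T\<^bsup>p-1\<^esup>\<close>.\<close>
  have "T u = 4 * y"
    using y iter_diff[of 1 "T w'" w'] unfolding u_def by simp
  then have "(T ^^ p) u = 4 * (T ^^ p') y"
    unfolding p' by (simp add: funpow_Suc_right iter_quadruple del: funpow.simps)
  then have u4: "u = 4 * (T ^^ p') y" using up by simp
  define y' where "y' = (T ^^ p') y"
  have "4 * (T ^^ p) y' = 4 * y'"
    using up u4 unfolding y'_def iter_quadruple[symmetric] by simp
  then have y'p: "(T ^^ p) y' = y'" by (rule cancel_4)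
  have "(T ^^ Suc i) w = w + 4 * (z + y')"
    using u4 z(2) unfolding u_def y'_def[symmetric] w'_def by (simp add: algebra_simps)
  then show ?case using z(1) y'p iter_add by metis
qed

text \<open>
  Modulo 4 the sum over the orbit is \<open>q x\<close>, so \<open>q x\<close> is divisible by 4. A prime is not divisible by 4,
  hence \<open>x\<close> is even, and its half satisfies the same hypotheses.
\<close>

lemma periodic_imp_half:
  assumes p: "p > 0" and x: "(T ^^ p) x = x" and q: "Factorial_Ring.prime (q::nat)"
    and sum: "(\<Sum>i<q. (T ^^ (p' * i)) x) = 0"
  shows "\<exists>y. x = 2 * y \<and> (T ^^ p) y = y \<and> (\<Sum>i<q. (T ^^ (p' * i)) y) = 0"
proof -
  have "\<exists>z. \<forall>i. (T ^^ i) x = x + 4 * z i"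
    using iter_one_mod_4[OF p x] by metis
  then obtain z where z: "\<And>i. (T ^^ i) x = x + 4 * z i" by blast
  define Z where "Z = (\<Sum>i<q. z (p' * i))"
  have eq: "of_nat q * x + 4 * Z = 0"
    using sum unfolding z Z_def by (simp add: sum.distrib sum_distrib_left)
  have "\<exists>y. x = 2 * y"
  proof (cases "q = 2")
    case True
    then have "2 * x = 2 * (2 * (- Z))"
      using eq by (simp add: eq_neg_iff_add_eq_0 flip: mult.assoc)
    then show ?thesis using cancel_2 by blast
  next
    case False
    then obtain l where "q = 2 * l + 1"
      using q prime_odd_nat[of q] prime_ge_2_nat[of q] by (metis le_neq_implies_less oddE)
    then have "of_nat q * x = x + 2 * (of_nat l * x)"
      by (simp add: distrib_right mult.assoc)
    moreover have "4 * Z = 2 * (2 * Z)" by (simp flip: mult.assoc)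
    moreover define y where "y = of_nat l * x + 2 * Z"
    ultimately have "x + 2 * y = 0"
      using eq by (simp add: distrib_left add.assoc)
    then have "x = 2 * (- y)"
      by (simp add: eq_neg_iff_add_eq_0)
    then show ?thesis by blast
  qed
  then obtain y where y: "x = 2 * y" by blast
  have "(T ^^ p) y = y"
    using x unfolding y iter_double by (rule cancel_2)
  moreover have "(\<Sum>i<q. (T ^^ (p' * i)) y) = 0"
    using sum unfolding y iter_double sum_distrib_left[symmetric] by (auto intro: cancel_2)
  ultimately show ?thesis using y by blast
qed

text \<open>
  The difference \<open>u = T\<^bsup>p'\<^esup> v - v\<close> has vanishing orbit sum by telescoping, so it can be halved
  indefinitely and must be zero.
\<close>

lemma periodic_prime_reduction:
  assumes q: "Factorial_Ring.prime (q::nat)" and p': "p' > 0" and v: "(T ^^ (p' * q)) v = v"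
  shows "(T ^^ p') v = v"
proof -
  let ?p = "p' * q"
  let ?good = "\<lambda>x. (T ^^ ?p) x = x \<and> (\<Sum>i<q. (T ^^ (p' * i)) x) = 0"
  have p: "?p > 0" using q p' prime_gt_0_nat by simp
  define u where "u = (T ^^ p') v - v"
  have "(T ^^ ?p) u = u"
    unfolding u_def iter_diff v by (metis add.commute funpow_add o_apply v)
  moreover have "(\<Sum>i<q. (T ^^ (p' * i)) u) = (\<Sum>i<q. (T ^^ (p' * Suc i)) v - (T ^^ (p' * i)) v)"
    unfolding u_def iter_diff
    by (intro sum.cong refl) (metis add.commute funpow_add mult_Suc_right o_apply)
  then have "(\<Sum>i<q. (T ^^ (p' * i)) u) = 0"
    using sum_lessThan_telescope[of "\<lambda>i. (T ^^ (p' * i)) v" q] v by simp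
  ultimately have u: "?good u" by simp
  have "\<exists>y. u = 2 ^ k * y \<and> ?good y" for k
  proof (induction k)
    case 0
    then show ?case using u by auto
  next
    case (Suc k)
    then obtain y where "u = 2 ^ k * y" "?good y" by blast
    with periodic_imp_half[OF p _ q, of y p'] show ?case
      by (metis mult.assoc power_Suc2)
  qed
  then have "u = 0" by (intro separated) blast
  then show ?thesis by (simp add: u_def)
qed

theorem periodic_imp_fixed:
  assumes "p > 0" "(T ^^ p) v = v"
  shows "T v = v"
  using assms
proof (induction p rule: less_induct)
  case (less p)
  show ?case
  proof (cases "p = 1")
    case True
    then show ?thesis using less.prems by simp
  next
    case False
    then obtain q where q: "Factorial_Ring.prime q" "q dvd p" using prime_factor_nat by blast
    then obtain p' where p': "p = p' * q" by (metis dvd_def mult.commute)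
    have "p' > 0" using less.prems p' by (cases p') auto
    moreover have "p' < p" using p' q \<open>p' > 0\<close> prime_gt_1_nat[of q] by simp
    ultimately show ?thesis
      using less.IH[of p'] periodic_prime_reduction[OF q(1), of p' v] less.prems p' by blast
  qed
qed

text \<open>
  A vanishing orbit sum makes \<open>f\<close> periodic, by telescoping; then \<open>f\<close> is fixed, and the sum is \<open>p f\<close>.
\<close>

corollary orbit_sum_zero:
  assumes "p > 0" "(\<Sum>i<p. (T ^^ i) f) = 0"
  shows "f = 0"
proof -
  have "(\<Sum>i<p. (T ^^ Suc i) f - (T ^^ i) f) = T (\<Sum>i<p. (T ^^ i) f) - (\<Sum>i<p. (T ^^ i) f)"
    by (simp add: sum_subtractf T_sum)
  then have "(T ^^ p) f - f = 0"
    using sum_lessThan_telescope[of "\<lambda>i. (T ^^ i) f" p] assms(2) iter_zero[of 1] by simp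
  then have "T f = f" using periodic_imp_fixed[of p f] assms(1) by simp
  then have "(T ^^ i) f = f" for i by (induction i) auto
  then have "of_nat p * f = 0" using assms(2) by simp
  then show ?thesis using torsion_free assms(1) by blast
qed

end

text \<open>
  By the pigeonhole principle the orbit of \<open>x\<close> enters a cycle whose length is at most \<open>s\<close> and
  hence divides \<open>s!\<close>.
\<close>

lemma iterate_eventually_periodic:
  assumes "finite A" "card A \<le> s" "x \<in> A" "f ` A \<subseteq> A" "c + 1 \<ge> s"
  shows "(f ^^ (c + fact s)) x = (f ^^ c) x"
proof -
  have in_A: "(f ^^ i) x \<in> A" for i
    using assms(3,4) by (induction i) auto
  have "\<not> inj_on (\<lambda>i. (f ^^ i) x) {..s}"
    using card_inj_on_le[of "\<lambda>i. (f ^^ i) x" "{..s}" A] in_A assms(1,2) by fastforce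
  then obtain a b where ab: "a < b" "b \<le> s" "(f ^^ a) x = (f ^^ b) x"
    unfolding inj_on_def by (metis atMost_iff linorder_neqE_nat)
  define d where "d = b - a"
  have step: "(f ^^ (e + d)) x = (f ^^ e) x" if "e \<ge> a" for e
  proof -
    have "e + d = (e - a) + b" "e = (e - a) + a"
      using that ab(1) by (simp_all add: d_def)
    then show ?thesis using ab(3) by (metis funpow_add o_apply)
  qed
  have "d dvd fact s" using ab by (intro dvd_fact) (auto simp: d_def)
  then obtain t where t: "fact s = d * t" by blast
  have "(f ^^ (c + d * t)) x = (f ^^ c) x"
  proof (induction t)
    case (Suc t)
    have "a \<le> c + d * t" using ab assms(5) by simp
    from step[OF this] Suc show ?case by (simp add: algebra_simps)
  qed simp
  then show ?thesis using t by simp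
qed

section \<open>Power series in non-commuting variables\<close>

text \<open>
  A series assigns an integer coefficient to every word in the variables, that is, to every
  non-commutative monomial.
\<close>

typedef 'a nc_series = "UNIV :: ('a list \<Rightarrow> int) set"
  morphisms nc_coeff Nc_Series ..

lemma nc_coeff_Nc_Series [simp]: "nc_coeff (Nc_Series f) w = f w"
  by (simp add: Nc_Series_inverse)

lemma nc_series_eqI: "(\<And>w. nc_coeff f w = nc_coeff g w) \<Longrightarrow> f = g"
  by (metis nc_coeff_inject ext)

text \<open>
  The series \<open>left_deriv i f\<close> collects the monomials of \<open>f\<close> that start with \<open>i\<close> and strips that letter:
  \<open>f = f\<^sub>0 + \<Sum>\<^sub>i X\<^sub>i \<cdot> left_deriv i f\<close>. This decomposition turns identities of series into inductions
  over words.
\<close>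

definition left_deriv :: "'a \<Rightarrow> 'a nc_series \<Rightarrow> 'a nc_series" where
  "left_deriv i f = Nc_Series (\<lambda>w. nc_coeff f (i # w))"

lemma nc_coeff_left_deriv [simp]: "nc_coeff (left_deriv i f) w = nc_coeff f (i # w)"
  by (simp add: left_deriv_def)

instantiation nc_series :: (type) ring_1
begin

definition "0 = Nc_Series (\<lambda>_. 0)"
definition "1 = Nc_Series (\<lambda>w. if w = [] then 1 else 0)"
definition "f + g = Nc_Series (\<lambda>w. nc_coeff f w + nc_coeff g w)"
definition "f - g = Nc_Series (\<lambda>w. nc_coeff f w - nc_coeff g w)"
definition "- f = Nc_Series (\<lambda>w. - nc_coeff f w)"
definition "f * g = Nc_Series (\<lambda>w. \<Sum>k\<le>length w. nc_coeff f (take k w) * nc_coeff g (drop k w))"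

lemma nc_coeff_simps [simp]:
  "nc_coeff 0 w = 0"
  "nc_coeff 1 w = (if w = [] then 1 else 0)"
  "nc_coeff (f + g) w = nc_coeff f w + nc_coeff g w"
  "nc_coeff (f - g) w = nc_coeff f w - nc_coeff g w"
  "nc_coeff (- f) w = - nc_coeff f w"
  by (simp_all add: zero_nc_series_def one_nc_series_def plus_nc_series_def
      minus_nc_series_def uminus_nc_series_def)

lemma nc_coeff_mult:
  "nc_coeff (f * g) w = (\<Sum>k\<le>length w. nc_coeff f (take k w) * nc_coeff g (drop k w))"
  by (simp add: times_nc_series_def)

lemma nc_coeff_mult_Nil [simp]: "nc_coeff (f * g) [] = nc_coeff f [] * nc_coeff g []"
  by (simp add: nc_coeff_mult)

lemma nc_coeff_mult_Cons:
  "nc_coeff (f * g) (i # w) = nc_coeff f [] * nc_coeff g (i # w) + nc_coeff (left_deriv i f * g) w"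
  by (simp add: nc_coeff_mult sum.atMost_Suc_shift del: sum.atMost_Suc)

instance
proof
  fix f g h :: "'a nc_series"
  have distrib_right: "(f + g) * h = f * h + g * h" for f g h :: "'a nc_series"
    by (rule nc_series_eqI) (simp add: nc_coeff_mult distrib_right sum.distrib)
  show "(f + g) * h = f * h + g * h" by (rule distrib_right)
  show "f * (g + h) = f * g + f * h"
    by (rule nc_series_eqI) (simp add: nc_coeff_mult distrib_left sum.distrib)
  have "nc_coeff (f * g * h) w = nc_coeff (f * (g * h)) w" for w
  proof (induction w arbitrary: f)
    case (Cons i w)
    define e where "e = Nc_Series (\<lambda>w. nc_coeff f [] * nc_coeff (left_deriv i g) w)"
    have "left_deriv i (f * g) = e + left_deriv i f * g"
      by (rule nc_series_eqI) (simp add: nc_coeff_mult_Cons e_def)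
    moreover have "nc_coeff (e * h) w = nc_coeff f [] * nc_coeff (left_deriv i g * h) w"
      by (simp add: nc_coeff_mult sum_distrib_left mult.assoc e_def)
    ultimately show ?case
      using Cons[of "left_deriv i f"]
      by (simp add: nc_coeff_mult_Cons distrib_right) (simp add: algebra_simps)
  qed simp
  then show "f * g * h = f * (g * h)" by (rule nc_series_eqI)
  have "nc_coeff (1 * f) w = nc_coeff f w" for w
  proof (cases w)
    case (Cons i v)
    have "nc_coeff (left_deriv i 1 * f) v = 0" by (simp add: nc_coeff_mult)
    then show ?thesis using Cons by (simp add: nc_coeff_mult_Cons)
  qed simp
  then show "1 * f = f" by (rule nc_series_eqI)
  have "nc_coeff (f * 1) w = nc_coeff f w" for w
    by (induction w arbitrary: f) (simp_all add: nc_coeff_mult_Cons)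
  then show "f * 1 = f" by (rule nc_series_eqI)
  have "nc_coeff (0 :: 'a nc_series) [] \<noteq> nc_coeff 1 []" by simp
  then show "(0 :: 'a nc_series) \<noteq> 1" by metis
qed (rule nc_series_eqI, simp)+

end

lemma nc_coeff_of_nat_mult: "nc_coeff (of_nat k * f) w = int k * nc_coeff f w"
  by (induction k) (simp_all add: distrib_right)

lemma nc_coeff_numeral_mult: "nc_coeff (numeral k * f) w = numeral k * nc_coeff f w"
  using nc_coeff_of_nat_mult[of "numeral k" f w] by simp

lemma nc_coeff_power2_mult: "nc_coeff (2 ^ k * f) w = 2 ^ k * nc_coeff f w"
  by (induction k) (simp_all add: mult.assoc nc_coeff_numeral_mult)

lemma nc_coeff_sum: "nc_coeff (\<Sum>i\<in>A. g i) w = (\<Sum>i\<in>A. nc_coeff (g i) w)"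
  by (induction A rule: infinite_finite_induct) simp_all

lemma left_deriv_add: "left_deriv i (f + g) = left_deriv i f + left_deriv i g"
  by (rule nc_series_eqI) simp

lemma nc_series_torsion_free:
  fixes f :: "'a nc_series"
  assumes "q > 0" "of_nat q * f = 0"
  shows "f = 0"
proof (rule nc_series_eqI)
  fix w
  have "int q * nc_coeff f w = 0" using assms(2) nc_coeff_of_nat_mult[of q f w] by simp
  then show "nc_coeff f w = nc_coeff 0 w" using assms(1) by simp
qed

lemma nc_series_2_adically_separated:
  fixes f :: "'a nc_series"
  assumes "\<And>k. \<exists>g. f = 2 ^ k * g"
  shows "f = 0"
proof (rule nc_series_eqI)
  fix w
  define k where "k = nat \<bar>nc_coeff f w\<bar>"
  obtain g where "f = 2 ^ k * g" using assms by blast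
  then have "2 ^ k dvd nc_coeff f w" by (metis nc_coeff_power2_mult dvd_triv_left)
  moreover have "\<bar>nc_coeff f w\<bar> < 2 ^ k"
  proof -
    have "int k < int (2 ^ k)" by (simp only: of_nat_less_iff less_exp)
    then show ?thesis by (simp add: k_def)
  qed
  ultimately show "nc_coeff f w = nc_coeff 0 w"
    using dvd_imp_le_int[of "nc_coeff f w" "2 ^ k"] by fastforce
qed

lemma nc_series_4_dvd:
  fixes f :: "'a nc_series"
  assumes "\<And>w. 4 dvd nc_coeff f w"
  shows "\<exists>g. f = 4 * g"
proof
  show "f = 4 * Nc_Series (\<lambda>w. nc_coeff f w div 4)"
    using assms by (intro nc_series_eqI) (simp add: nc_coeff_numeral_mult)
qed

definition nc_var :: "'a \<Rightarrow> 'a nc_series" where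
  "nc_var i = Nc_Series (\<lambda>w. if w = [i] then 1 else 0)"

lemma nc_coeff_var [simp]: "nc_coeff (nc_var i) w = (if w = [i] then 1 else 0)"
  by (simp add: nc_var_def)

lemma left_deriv_var: "left_deriv j (nc_var i) = (if j = i then 1 else 0)"
  by (rule nc_series_eqI) simp

lemma nc_coeff_var_mult:
  "nc_coeff (nc_var i * f) w = (case w of [] \<Rightarrow> 0 | j # v \<Rightarrow> if j = i then nc_coeff f v else 0)"
  by (cases w) (simp_all add: nc_coeff_mult_Cons left_deriv_var)

definition homogeneous_part :: "nat \<Rightarrow> 'a nc_series \<Rightarrow> 'a nc_series" where
  "homogeneous_part k f = Nc_Series (\<lambda>w. if length w = k then nc_coeff f w else 0)"

lemma nc_coeff_homogeneous_part [simp]: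
  "nc_coeff (homogeneous_part k f) w = (if length w = k then nc_coeff f w else 0)"
  by (simp add: homogeneous_part_def)

section \<open>Tensor powers of a matrix\<close>

text \<open>
  On the homogeneous series of degree \<open>k\<close>, which form the \<open>k\<close>-th tensor power of the lattice \<open>\<int>\<^bsup>S\<^esup>\<close>, the
  map below is the \<open>k\<close>-th tensor power of the linear map \<open>X\<^sub>i \<mapsto> \<Sum>\<^sub>j M i j X\<^sub>j\<close>. Treating all degrees at
  once by recursion on the monomial avoids tensor products.
\<close>

primrec tensor_coeff :: "'a set \<Rightarrow> ('a \<Rightarrow> 'a \<Rightarrow> int) \<Rightarrow> 'a list \<Rightarrow> 'a nc_series \<Rightarrow> int" where
  "tensor_coeff S M [] f = nc_coeff f []"
| "tensor_coeff S M (j # w) f = (\<Sum>i\<in>S. M i j * tensor_coeff S M w (left_deriv i f))"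

definition tensor_map :: "'a set \<Rightarrow> ('a \<Rightarrow> 'a \<Rightarrow> int) \<Rightarrow> 'a nc_series \<Rightarrow> 'a nc_series" where
  "tensor_map S M f = Nc_Series (\<lambda>w. tensor_coeff S M w f)"

definition mat_mult :: "'a set \<Rightarrow> ('a \<Rightarrow> 'a \<Rightarrow> int) \<Rightarrow> ('a \<Rightarrow> 'a \<Rightarrow> int) \<Rightarrow> 'a \<Rightarrow> 'a \<Rightarrow> int" where
  "mat_mult S A B i j = (\<Sum>k\<in>S. A i k * B k j)"

lemma nc_coeff_tensor_map [simp]: "nc_coeff (tensor_map S M f) w = tensor_coeff S M w f"
  by (simp add: tensor_map_def)

lemma tensor_coeff_add:
  "tensor_coeff S M w (f + g) = tensor_coeff S M w f + tensor_coeff S M w g"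
  by (induction w arbitrary: f g) (simp_all add: left_deriv_add distrib_left sum.distrib)

lemma tensor_map_add: "tensor_map S M (f + g) = tensor_map S M f + tensor_map S M g"
  by (rule nc_series_eqI) (simp add: tensor_coeff_add)

lemma tensor_coeff_cong:
  "(\<And>v. length v = length w \<Longrightarrow> nc_coeff f v = nc_coeff g v)
    \<Longrightarrow> tensor_coeff S M w f = tensor_coeff S M w g"
proof (induction w arbitrary: f g)
  case (Cons j w)
  have "tensor_coeff S M w (left_deriv i f) = tensor_coeff S M w (left_deriv i g)" for i
    by (rule Cons.IH) (simp add: Cons.prems)
  then show ?case by simp
qed simp

lemma tensor_coeff_zero: "tensor_coeff S M w 0 = 0"
  using tensor_coeff_add[of S M w 0 0] by simp

lemma tensor_map_homogeneous_part:
  "tensor_map S M (homogeneous_part k f) = homogeneous_part k (tensor_map S M f)"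
proof (rule nc_series_eqI)
  fix w
  show "nc_coeff (tensor_map S M (homogeneous_part k f)) w
      = nc_coeff (homogeneous_part k (tensor_map S M f)) w"
    using tensor_coeff_cong[of w "homogeneous_part k f" f S M]
      tensor_coeff_cong[of w "homogeneous_part k f" 0 S M]
    by (cases "length w = k") (simp_all add: tensor_coeff_zero)
qed

lemma tensor_coeff_scale_sum:
  "tensor_coeff S M w (Nc_Series (\<lambda>v. \<Sum>i\<in>I. c i * nc_coeff (g i) v))
    = (\<Sum>i\<in>I. c i * tensor_coeff S M w (g i))"
proof (induction w arbitrary: g)
  case (Cons j w)
  have "left_deriv l (Nc_Series (\<lambda>v. \<Sum>i\<in>I. c i * nc_coeff (g i) v))
      = Nc_Series (\<lambda>v. \<Sum>i\<in>I. c i * nc_coeff (left_deriv l (g i)) v)" for l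
    by (rule nc_series_eqI) simp
  then show ?case
    using Cons[of "\<lambda>i. left_deriv _ (g i)"]
    by (simp add: sum_distrib_left mult.left_commute) (rule sum.swap)
qed simp

text \<open>
  Vectors are rows: applying \<open>A\<close> first and \<open>B\<close> second corresponds to the product \<open>A B\<close>.
\<close>

lemma tensor_map_compose:
  "tensor_map S B (tensor_map S A f) = tensor_map S (mat_mult S A B) f"
proof (rule nc_series_eqI)
  fix w
  show "nc_coeff (tensor_map S B (tensor_map S A f)) w = nc_coeff (tensor_map S (mat_mult S A B) f) w"
  proof (induction w arbitrary: f)
    case (Cons j w)
    have "left_deriv k (tensor_map S A f)
        = Nc_Series (\<lambda>v. \<Sum>i\<in>S. A i k * nc_coeff (tensor_map S A (left_deriv i f)) v)" for k
      by (rule nc_series_eqI) simp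
    then have "nc_coeff (tensor_map S B (tensor_map S A f)) (j # w)
        = (\<Sum>k\<in>S. B k j * (\<Sum>i\<in>S. A i k * tensor_coeff S B w (tensor_map S A (left_deriv i f))))"
      by (simp only: nc_coeff_tensor_map[of S B] tensor_coeff.simps tensor_coeff_scale_sum)
    also have "\<dots> = (\<Sum>i\<in>S. \<Sum>k\<in>S. A i k * B k j * tensor_coeff S B w (tensor_map S A (left_deriv i f)))"
      by (subst sum.swap) (simp add: sum_distrib_left mult.assoc mult.left_commute)
    also have "\<dots> = nc_coeff (tensor_map S (mat_mult S A B) f) (j # w)"
      using Cons by (simp add: mat_mult_def[where j = j] sum_distrib_right)
    finally show ?case .
  qed simp
qed

lemma tensor_coeff_mod:
  assumes "\<And>i j. i \<in> S \<Longrightarrow> j \<in> S \<Longrightarrow> A i j mod q = B i j mod q"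
    and "\<And>i j. i \<in> S \<Longrightarrow> j \<notin> S \<Longrightarrow> A i j = 0 \<and> B i j = 0"
  shows "tensor_coeff S A w f mod q = tensor_coeff S B w f mod q"
proof (induction w arbitrary: f)
  case (Cons j w)
  have "A i j mod q = B i j mod q" if "i \<in> S" for i
    using assms that by (cases "j \<in> S") auto
  then have "(A i j * tensor_coeff S A w (left_deriv i f)) mod q
      = (B i j * tensor_coeff S B w (left_deriv i f)) mod q" if "i \<in> S" for i
    using Cons that by (intro mod_mult_cong) auto
  then have "(\<Sum>i\<in>S. (A i j * tensor_coeff S A w (left_deriv i f)) mod q)
      = (\<Sum>i\<in>S. (B i j * tensor_coeff S B w (left_deriv i f)) mod q)"
    by (rule sum.cong[OF refl])
  then show ?case
    unfolding tensor_coeff.simps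
    using mod_sum_eq[of "\<lambda>i. A i j * tensor_coeff S A w (left_deriv i f)" q S]
      mod_sum_eq[of "\<lambda>i. B i j * tensor_coeff S B w (left_deriv i f)" q S]
    by argo
qed simp

text \<open>
  The powers start at exponent 1, since the identity matrix indexed by \<open>S\<close> does not act as the identity
  on series that involve variables outside \<open>S\<close>.
\<close>

lemma tensor_map_funpow:
  "(tensor_map S M ^^ Suc c) f = tensor_map S (((\<lambda>A. mat_mult S A M) ^^ c) M) f"
  by (induction c) (simp_all add: tensor_map_compose)

definition restrict_mod4 :: "'a set \<Rightarrow> ('a \<Rightarrow> 'a \<Rightarrow> int) \<Rightarrow> 'a \<times> 'a \<Rightarrow> int" where
  "restrict_mod4 S M = restrict (\<lambda>(i, j). M i j mod 4) (S \<times> S)"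

text \<open>
  There are at most \<open>4\<^bsup>N N\<^esup>\<close> matrices modulo 4, and each power of \<open>M\<close> modulo 4 is determined by the
  preceding one. The iteration starts at \<open>M\<close>, so step \<open>c\<close> yields the power of exponent \<open>c + 1\<close>.
\<close>

lemma mat_power_eventually_periodic_mod4:
  fixes M :: "'a \<Rightarrow> 'a \<Rightarrow> int"
  assumes S: "finite S" "card S \<le> N" and c: "c + 1 \<ge> 4 ^ (N * N)"
  defines "P \<equiv> \<lambda>c. ((\<lambda>A. mat_mult S A M) ^^ c) M"
  assumes ij: "i \<in> S" "j \<in> S"
  shows "P (c + fact (4 ^ (N * N))) i j mod 4 = P c i j mod 4"
proof -
  let ?R = "restrict_mod4 S"
  let ?X = "S \<times> S \<rightarrow>\<^sub>E {0..<4::int}"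
  define F where "F x = ?R (mat_mult S (curry x) M)" for x
  have in_X: "?R A \<in> ?X" for A
    by (auto simp: restrict_mod4_def)
  have card: "finite ?X" "card ?X \<le> 4 ^ (N * N)"
    using S by (auto simp: card_funcsetE card_cartesian_product intro!: finite_PiE power_increasing mult_le_mono)
  have F_R: "F (?R A) = ?R (mat_mult S A M)" for A
  proof -
    have "mat_mult S (curry (?R A)) M i j mod 4 = mat_mult S A M i j mod 4" if "i \<in> S" for i j
    proof -
      have "mat_mult S (curry (?R A)) M i j = (\<Sum>k\<in>S. (A i k mod 4) * M k j)"
        unfolding mat_mult_def using that by (intro sum.cong) (auto simp: restrict_mod4_def)
      also have "\<dots> mod 4 = (\<Sum>k\<in>S. A i k * M k j mod 4) mod 4"
        by (subst mod_sum_eq[symmetric]) (simp add: mod_mult_left_eq)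
      finally show ?thesis by (simp add: mod_sum_eq mat_mult_def)
    qed
    then show ?thesis by (auto simp: F_def restrict_mod4_def fun_eq_iff restrict_def)
  qed
  have iterate: "(F ^^ c) (?R M) = ?R (P c)" for c
    by (induction c) (simp_all add: P_def F_R)
  have "(F ^^ (c + fact (4 ^ (N * N)))) (?R M) = (F ^^ c) (?R M)"
    by (rule iterate_eventually_periodic[OF card in_X _ c]) (use in_X in \<open>unfold F_def, blast\<close>)
  then have "?R (P (c + fact (4 ^ (N * N)))) (i, j) = ?R (P c) (i, j)"
    unfolding iterate by simp
  then show ?thesis using ij by (simp add: restrict_mod4_def)
qed

text \<open>
  With \<open>s = 4\<^bsup>N N\<^esup>\<close>, the powers of \<open>M\<close> modulo 4 of exponents \<open>s!\<close> and \<open>2 s!\<close> agree, and congruent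
  matrices have congruent tensor powers in every degree. Hence this one exponent, which depends on \<open>N\<close>
  only, makes all tensor powers idempotent modulo 4.
\<close>

lemma mod4_idempotent_tensor_power:
  fixes M :: "'a \<Rightarrow> 'a \<Rightarrow> int"
  assumes S: "finite S" "card S \<le> N"
    and M: "\<And>i j. i \<in> S \<Longrightarrow> j \<notin> S \<Longrightarrow> M i j = 0"
  shows "mod4_idempotent (tensor_map S M ^^ fact (4 ^ (N * N)))"
proof
  let ?s = "4 ^ (N * N) :: nat"
  let ?T = "tensor_map S M"
  define P where "P c = ((\<lambda>A. mat_mult S A M) ^^ c) M" for c
  fix f g :: "'a nc_series"
  show "(?T ^^ fact ?s) (f + g) = (?T ^^ fact ?s) f + (?T ^^ fact ?s) g"
    by (rule funpow_additive) (rule tensor_map_add)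
  have "\<exists>c. fact ?s = Suc c \<and> c + 1 \<ge> ?s"
    using fact_ge_self[of ?s] by (metis Suc_eq_plus1 fact_gt_zero gr0_conv_Suc)
  then obtain c where c: "fact ?s = Suc c" "c + 1 \<ge> ?s" by blast
  have P_outside: "P e i j = 0" if "i \<in> S" "j \<notin> S" for e i j
    using that M by (cases e) (auto simp: P_def mat_mult_def)
  have "tensor_coeff S (P (c + fact ?s)) w f mod 4 = tensor_coeff S (P c) w f mod 4" for w
    using mat_power_eventually_periodic_mod4[OF S c(2), where M = M] P_outside
    by (intro tensor_coeff_mod) (auto simp: P_def)
  moreover have "(?T ^^ fact ?s) ((?T ^^ fact ?s) f) = tensor_map S (P (c + fact ?s)) f"
    using tensor_map_funpow[where c = "c + fact ?s" and S = S and M = M and f = f] c(1)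
    unfolding P_def by (metis add_Suc funpow_add o_apply)
  moreover have "(?T ^^ fact ?s) f = tensor_map S (P c) f"
    unfolding c(1) P_def by (rule tensor_map_funpow)
  ultimately have "4 dvd nc_coeff ((?T ^^ fact ?s) ((?T ^^ fact ?s) f) - (?T ^^ fact ?s) f) w" for w
    by (simp add: mod_eq_dvd_iff)
  then show "\<exists>g. (?T ^^ fact ?s) ((?T ^^ fact ?s) f) - (?T ^^ fact ?s) f = 4 * g"
    by (rule nc_series_4_dvd)
next
  fix q :: nat and f :: "'a nc_series"
  assume "q > 0" "of_nat q * f = 0"
  then show "f = 0" by (rule nc_series_torsion_free)
next
  fix f :: "'a nc_series"
  assume "\<And>k. \<exists>g. f = 2 ^ k * g"
  then show "f = 0" by (rule nc_series_2_adically_separated)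
qed

section \<open>The Magnus expansion\<close>

text \<open>
  This is the inverse \<open>1 - X\<^sub>i + X\<^sub>i\<^sup>2 - \<dots>\<close> of \<open>1 + X\<^sub>i\<close>.
\<close>

definition geometric :: "'a \<Rightarrow> 'a nc_series" where
  "geometric i = Nc_Series (\<lambda>w. if set w \<subseteq> {i} then (- 1) ^ length w else 0)"

definition magnus_letter :: "'a \<times> bool \<Rightarrow> 'a nc_series" where
  "magnus_letter a = (if snd a then 1 + nc_var (fst a) else geometric (fst a))"

primrec magnus :: "('a \<times> bool) list \<Rightarrow> 'a nc_series" where
  "magnus [] = 1"
| "magnus (a # w) = magnus_letter a * magnus w"

lemma var_mult_geometric: "(1 + nc_var i) * geometric i = 1"
proof (rule nc_series_eqI)
  fix w
  show "nc_coeff ((1 + nc_var i) * geometric i) w = nc_coeff 1 w"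
    by (cases w) (auto simp: distrib_right nc_coeff_var_mult geometric_def)
qed

lemma geometric_mult_var: "geometric i * (1 + nc_var i) = 1"
proof (rule nc_series_eqI)
  fix w
  show "nc_coeff (geometric i * (1 + nc_var i)) w = nc_coeff 1 w"
  proof (induction w)
    case (Cons j w)
    have "left_deriv j (geometric i) = (if j = i then - geometric i else 0)"
      by (rule nc_series_eqI) (simp add: geometric_def)
    then show ?case
      using Cons by (auto simp: nc_coeff_mult_Cons geometric_def)
  qed (simp add: geometric_def)
qed

lemma magnus_letter_inverse: "magnus_letter a * magnus_letter (inv_letter a) = 1"
  by (simp add: magnus_letter_def inv_letter_def var_mult_geometric geometric_mult_var)

lemma magnus_cancel_cons: "magnus (cancel_cons a w) = magnus_letter a * magnus w"
  by (cases w) (auto simp: magnus_letter_inverse simp flip: mult.assoc)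

lemma magnus_mult: "magnus (foldr cancel_cons u w) = magnus u * magnus w"
  by (induction u) (simp_all add: magnus_cancel_cons mult.assoc)

lemma nc_coeff_magnus_letter_Nil: "nc_coeff (magnus_letter a) [] = 1"
  by (simp add: magnus_letter_def geometric_def)

lemma nc_coeff_magnus_Nil [simp]: "nc_coeff (magnus w) [] = 1"
  by (induction w) (simp_all add: nc_coeff_magnus_letter_Nil)

lemma nc_coeff_magnus_letter_singleton:
  "nc_coeff (magnus_letter a) [j] = (if j = fst a then if snd a then 1 else - 1 else 0)"
  by (auto simp: magnus_letter_def geometric_def)

lemma nc_coeff_mult_singleton:
  "nc_coeff (f * g) [j] = nc_coeff f [] * nc_coeff g [j] + nc_coeff f [j] * nc_coeff g []"
  by (simp add: nc_coeff_mult_Cons)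

lemma nc_coeff_magnus_singleton_outside:
  "fst ` set w \<subseteq> S \<Longrightarrow> j \<notin> S \<Longrightarrow> nc_coeff (magnus w) [j] = 0"
  by (induction w)
    (auto simp: nc_coeff_mult_singleton nc_coeff_magnus_letter_Nil nc_coeff_magnus_letter_singleton)

text \<open>
  At a monomial without equal neighbours only the linear part \<open>\<plusminus>X\<^sub>i\<close> of a letter contributes, because
  the higher terms of the geometric series contain \<open>X\<^sub>i X\<^sub>i\<close>.
\<close>

lemma nc_coeff_magnus_letter_mult:
  assumes "distinct_adj u"
  shows "nc_coeff (magnus_letter a * f) u = nc_coeff f u +
    (case u of [] \<Rightarrow> 0 | j # v \<Rightarrow> if j = fst a then (if snd a then 1 else - 1) * nc_coeff f v else 0)"
proof (cases "snd a")
  case True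
  then show ?thesis
    by (simp add: magnus_letter_def distrib_right nc_coeff_var_mult split: list.split)
next
  case False
  define g where "g = magnus_letter a * f"
  have "f = (1 + nc_var (fst a)) * g"
    using False by (simp add: g_def magnus_letter_def var_mult_geometric flip: mult.assoc)
  then have f: "nc_coeff f v = nc_coeff g v +
      (case v of [] \<Rightarrow> 0 | j # v' \<Rightarrow> if j = fst a then nc_coeff g v' else 0)" for v
    by (simp add: distrib_right nc_coeff_var_mult)
  show ?thesis
    unfolding g_def[symmetric] f
    using False assms by (cases u rule: remdups_adj.cases) auto
qed

definition syllables :: "('a \<times> bool) list \<Rightarrow> 'a list" where
  "syllables w = remdups_adj (map fst w)"

lemma distinct_adj_syllables: "distinct_adj (syllables w)"
  by (simp add: syllables_def distinct_adj_remdups_adj)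

text \<open>
  Write a reduced word as \<open>x\<^sub>1\<^bsup>e1\<^esup> \<dots> x\<^sub>r\<^bsup>er\<^esup>\<close> with nonzero exponents and distinct neighbouring
  generators. At the monomial \<open>X\<^sub>1 \<dots> X\<^sub>r\<close> its expansion has the coefficient \<open>e1 \<cdots> er\<close>, which is nonzero.
  For an induction over letters, the third conjunct says that \<open>e1\<close> has the sign of the first letter:
  the coefficient at \<open>X\<^sub>1 \<dots> X\<^sub>r\<close> is \<open>e1\<close> times the one at \<open>X\<^sub>2 \<dots> X\<^sub>r\<close>. The first two conjuncts
  make the unwanted terms vanish when a letter is prepended.
\<close>

lemma magnus_at_syllables:
  assumes "reduced (a # w)"
  shows "(\<forall>u. distinct_adj u \<longrightarrow> length u > length (syllables (a # w)) \<longrightarrow> nc_coeff (magnus (a # w)) u = 0)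
    \<and> (\<forall>u. distinct_adj u \<longrightarrow> length u \<ge> length (syllables (a # w)) \<longrightarrow> hd u \<noteq> fst a
          \<longrightarrow> nc_coeff (magnus (a # w)) u = 0)
    \<and> (if snd a then 1 else - 1) * nc_coeff (magnus (a # w)) (syllables (a # w))
        * nc_coeff (magnus (a # w)) (tl (syllables (a # w))) > 0"
  using assms
proof (induction w arbitrary: a)
  case Nil
  show ?case
    by (auto simp: syllables_def nc_coeff_magnus_letter_mult nc_coeff_magnus_letter_singleton
        nc_coeff_magnus_letter_Nil split: list.splits
        simp del: mult_1_right)
next
  case (Cons b w)
  let ?m = "magnus (b # w)" and ?s = "syllables (b # w)"
  let ?e = "if snd a then 1 else - 1 :: int"
  have red: "reduced (b # w)" and b: "b \<noteq> inv_letter a"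
    using Cons.prems by (auto simp: reduced_def)
  from Cons.IH[OF red]
  have long: "\<And>u. distinct_adj u \<Longrightarrow> length u > length ?s \<Longrightarrow> nc_coeff ?m u = 0"
    and other: "\<And>u. distinct_adj u \<Longrightarrow> length u \<ge> length ?s \<Longrightarrow> hd u \<noteq> fst b \<Longrightarrow> nc_coeff ?m u = 0"
    and pos: "(if snd b then 1 else - 1) * nc_coeff ?m ?s * nc_coeff ?m (tl ?s) > 0"
    by blast+
  have coeff: "nc_coeff (magnus (a # b # w)) u = nc_coeff ?m u +
      (case u of [] \<Rightarrow> 0 | j # v \<Rightarrow> if j = fst a then ?e * nc_coeff ?m v else 0)" if "distinct_adj u" for u
    using nc_coeff_magnus_letter_mult[OF that, of a ?m] by simp
  have "?s \<noteq> []" "hd ?s = fst b" by (simp_all add: syllables_def hd_remdups_adj del: remdups_adj.simps)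
  then obtain s where s: "?s = fst b # s" by (cases ?s) auto
  have adj: "distinct_adj (fst b # s)" using distinct_adj_syllables[of "b # w"] s by simp
  show ?case
  proof (cases "fst a = fst b")
    case True
    then have ab: "a = b" using b by (auto simp: inv_letter_def prod_eq_iff)
    have s': "syllables (a # b # w) = fst b # s" using s True by (simp add: syllables_def)
    have zero: "nc_coeff (magnus (a # b # w)) u = 0"
      if u: "distinct_adj u" "length u > length ?s \<or> length u \<ge> length ?s \<and> hd u \<noteq> fst a" for u
    proof -
      have "nc_coeff ?m u = 0" using u long other True by metis
      moreover have "nc_coeff ?m v = 0" if v: "u = fst a # v" for v
      proof (rule other)
        show "distinct_adj v" using u(1) v by (cases v) auto
        show "length v \<ge> length ?s" using u(2) v by auto
        then have "v \<noteq> []" using s by auto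
        then show "hd v \<noteq> fst b" using u(1) v True by (cases v) auto
      qed
      ultimately show ?thesis using coeff[OF u(1)] by (auto split: list.splits)
    qed
    have adj_s: "distinct_adj s" using adj by (cases s) auto
    let ?x = "nc_coeff ?m s" and ?y = "nc_coeff ?m (fst b # s)"
    have c1: "nc_coeff (magnus (a # b # w)) (fst b # s) = ?y + ?e * ?x"
      using coeff[OF adj] True by simp
    have c2: "nc_coeff (magnus (a # b # w)) s = ?x"
      using coeff[OF adj_s] adj True by (auto split: list.splits)
    have "?e * (?y + ?e * ?x) * ?x = ?e * ?y * ?x + ?x * ?x"
      by (simp add: algebra_simps)
    moreover have "?e * ?y * ?x > 0"
      using pos s ab by simp
    ultimately have "?e * (?y + ?e * ?x) * ?x > 0"
      using zero_le_square[of ?x] by linarith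
    then have "?e * nc_coeff (magnus (a # b # w)) (fst b # s) * nc_coeff (magnus (a # b # w)) s > 0"
      by (simp only: c1 c2)
    then show ?thesis using zero s s' by simp
  next
    case False
    then have s': "syllables (a # b # w) = fst a # ?s" using s
      by (auto simp: syllables_def remdups_adj_Cons)
    have adj': "distinct_adj (fst a # ?s)" using distinct_adj_syllables[of "a # b # w"] s' by simp
    have zero: "nc_coeff (magnus (a # b # w)) u = 0"
      if u: "distinct_adj u" "length u > Suc (length ?s) \<or> length u \<ge> Suc (length ?s) \<and> hd u \<noteq> fst a" for u
    proof -
      have "nc_coeff ?m u = 0" using u by (intro long) auto
      moreover have "nc_coeff ?m v = 0" if v: "u = fst a # v" for v
      proof (rule long)
        show "distinct_adj v" using u(1) v by (cases v) auto
        show "length v > length ?s" using u(2) v by auto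
      qed
      ultimately show ?thesis using coeff[OF u(1)] by (auto split: list.splits)
    qed
    have "nc_coeff ?m (fst a # ?s) = 0"
      using adj' by (intro long) auto
    then have "nc_coeff (magnus (a # b # w)) (fst a # ?s) = ?e * nc_coeff ?m ?s"
      using coeff[OF adj'] by simp
    moreover have "nc_coeff (magnus (a # b # w)) ?s = nc_coeff ?m ?s"
      using coeff[of ?s] adj False s by simp
    moreover have "nc_coeff ?m ?s \<noteq> 0" using pos by auto
    then have "nc_coeff ?m ?s * nc_coeff ?m ?s > 0" by (simp add: zero_less_mult_iff) linarith
    ultimately have "?e * nc_coeff (magnus (a # b # w)) (fst a # ?s) * nc_coeff (magnus (a # b # w)) ?s > 0"
      by simp
    then show ?thesis using zero s' by simp
  qed
qed

text \<open>
  Magnus' theorem. The coefficient at the monomial of its syllables detects a nonempty reduced word.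
\<close>

theorem magnus_faithful:
  assumes "reduced w" "magnus w = 1"
  shows "w = []"
proof (rule ccontr)
  assume "w \<noteq> []"
  then obtain a v where w: "w = a # v" by (cases w) auto
  then have "nc_coeff (magnus w) (syllables w) \<noteq> 0" and "syllables w \<noteq> []"
    using magnus_at_syllables[of a v] assms(1) by (auto simp: syllables_def)
  then show False using assms(2) by simp
qed

section \<open>Endomorphisms as substitutions\<close>

text \<open>
  The series \<open>nc_subst S P f\<close> is obtained from \<open>f\<close> by substituting \<open>P i\<close> for \<open>X\<^sub>i\<close>. The recursion is
  \<open>f\<^sub>0 + \<Sum>\<^sub>i P\<^sub>i \<cdot> nc_subst S P (left_deriv i f)\<close> with the constant terms of the \<open>P\<^sub>i\<close> taken to be zero, so
  that each coefficient is a finite sum.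
\<close>

function subst_coeff :: "'a set \<Rightarrow> ('a \<Rightarrow> 'a nc_series) \<Rightarrow> 'a list \<Rightarrow> 'a nc_series \<Rightarrow> int" where
  "subst_coeff S P [] f = nc_coeff f []"
| "subst_coeff S P (j # w) f = (\<Sum>i\<in>S. \<Sum>k\<le>length w.
      nc_coeff (P i) (j # take k w) * subst_coeff S P (drop k w) (left_deriv i f))"
  by pat_completeness auto
termination by (relation "measure (\<lambda>(S, P, w, f). length w)") auto

definition nc_subst :: "'a set \<Rightarrow> ('a \<Rightarrow> 'a nc_series) \<Rightarrow> 'a nc_series \<Rightarrow> 'a nc_series" where
  "nc_subst S P f = Nc_Series (\<lambda>w. subst_coeff S P w f)"

lemma nc_coeff_subst [simp]: "nc_coeff (nc_subst S P f) w = subst_coeff S P w f"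
  by (simp add: nc_subst_def)

lemma nc_subst_add: "nc_subst S P (f + g) = nc_subst S P f + nc_subst S P g"
proof (rule nc_series_eqI)
  fix w
  show "nc_coeff (nc_subst S P (f + g)) w = nc_coeff (nc_subst S P f + nc_subst S P g) w"
    by (induction S P w f arbitrary: g rule: subst_coeff.induct)
      (simp_all add: left_deriv_add distrib_left sum.distrib)
qed

lemma nc_subst_zero: "nc_subst S P 0 = 0"
  using nc_subst_add[of S P 0 0] by simp

lemma nc_subst_one: "nc_subst S P 1 = 1"
proof (rule nc_series_eqI)
  fix w :: "'a list"
  have "left_deriv i (1 :: 'a nc_series) = 0" for i by (rule nc_series_eqI) simp
  moreover have "subst_coeff S P v 0 = 0" for v
    by (metis nc_coeff_subst nc_subst_zero nc_coeff_simps(1))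
  ultimately show "nc_coeff (nc_subst S P 1) w = nc_coeff 1 w"
    by (cases w) simp_all
qed

lemma nc_subst_unfold:
  assumes "\<And>i. i \<in> S \<Longrightarrow> nc_coeff (P i) [] = 0"
  shows "nc_subst S P f = Nc_Series (\<lambda>w. if w = [] then nc_coeff f [] else 0)
    + (\<Sum>i\<in>S. P i * nc_subst S P (left_deriv i f))"
proof (rule nc_series_eqI)
  fix w
  show "nc_coeff (nc_subst S P f) w = nc_coeff (Nc_Series (\<lambda>w. if w = [] then nc_coeff f [] else 0)
    + (\<Sum>i\<in>S. P i * nc_subst S P (left_deriv i f))) w"
    using assms
    by (cases w) (simp_all add: nc_coeff_sum nc_coeff_mult_Cons nc_coeff_mult[of "left_deriv _ _"] cong: sum.cong)
qed

text \<open>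
  Multiplicativity is proved only for the factor \<open>1 + X\<^sub>i\<close> on the left, which is all that an induction
  over the letters of a word uses.
\<close>

lemma nc_subst_var_mult:
  assumes S: "finite S" "i \<in> S" and P: "\<And>i. i \<in> S \<Longrightarrow> nc_coeff (P i) [] = 0"
  shows "nc_subst S P ((1 + nc_var i) * f) = (1 + P i) * nc_subst S P f"
proof -
  let ?g = "(1 + nc_var i) * f"
  have deriv: "left_deriv j ?g = left_deriv j f + (if j = i then f else 0)" for j
    by (rule nc_series_eqI) (simp add: distrib_right nc_coeff_var_mult)
  let ?sum = "\<lambda>f. \<Sum>j\<in>S. P j * nc_subst S P (left_deriv j f)"
  let ?const = "\<lambda>f. Nc_Series (\<lambda>w. if w = [] then nc_coeff f [] else 0)"
  have "?sum ?g = (\<Sum>j\<in>S. P j * nc_subst S P (left_deriv j f) + (if j = i then P i * nc_subst S P f else 0))"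
    by (intro sum.cong) (auto simp: deriv nc_subst_add nc_subst_zero distrib_left)
  then have sum: "?sum ?g = ?sum f + P i * nc_subst S P f"
    using S by (simp add: sum.distrib)
  have const: "nc_coeff ?g [] = nc_coeff f []" by simp
  have unfold: "nc_subst S P h = ?const h + ?sum h" for h
    by (rule nc_subst_unfold) (rule P)
  have "nc_subst S P ?g = nc_subst S P f + P i * nc_subst S P f"
    using unfold[of ?g] unfolding sum const using unfold[of f] by (metis add.assoc)
  then show ?thesis by (simp only: distrib_right mult_1_left)
qed

text \<open>
  In the lowest degree of \<open>f\<close> only the linear parts of the substituted series matter.
\<close>

lemma subst_leading_coeff:
  assumes "\<And>v. length v < k \<Longrightarrow> nc_coeff f v = 0" "length w \<le> k"
  shows "subst_coeff S P w f = tensor_coeff S (\<lambda>i j. nc_coeff (P i) [j]) w f"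
  using assms
proof (induction "length w" arbitrary: w f k rule: less_induct)
  case less
  show ?case
  proof (cases w)
    case (Cons j v)
    have deriv: "nc_coeff (left_deriv i f) u = 0" if "length u < k - 1" for i u
      using less.prems(1) that by simp
    have IH: "subst_coeff S P (drop e v) (left_deriv i f)
        = tensor_coeff S (\<lambda>i j. nc_coeff (P i) [j]) (drop e v) (left_deriv i f)" for e i
      using less.prems(2) Cons by (intro less.hyps[OF _ deriv]) auto
    have "subst_coeff S P (drop e v) (left_deriv i f) = 0" if "0 < e" "e \<le> length v" for e i
    proof -
      have "length (drop e v) < k - 1" using that less.prems(2) Cons by auto
      then have "tensor_coeff S (\<lambda>i j. nc_coeff (P i) [j]) (drop e v) (left_deriv i f)
          = tensor_coeff S (\<lambda>i j. nc_coeff (P i) [j]) (drop e v) 0"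
        using deriv by (intro tensor_coeff_cong) simp
      then show ?thesis by (simp add: IH tensor_coeff_zero)
    qed
    then have "(\<Sum>e\<le>length v. nc_coeff (P i) (j # take e v) * subst_coeff S P (drop e v) (left_deriv i f))
        = (\<Sum>e\<le>length v. if e = 0 then nc_coeff (P i) [j] * subst_coeff S P v (left_deriv i f) else 0)" for i
      by (intro sum.cong) auto
    then show ?thesis
      using IH[of 0] by (simp add: Cons)
  qed simp
qed

lemma free_group_Cons:
  assumes "a # w \<in> carrier (free_group S)"
  shows "w \<in> carrier (free_group S)" "[a] \<in> carrier (free_group S)" "fst a \<in> S"
    "a # w = [a] \<otimes>\<^bsub>free_group S\<^esub> w"
  using assms reduced_tl[of a w] cancel_cons_reduced[of a w]
  by (auto simp: free_group_def reduced_def)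

lemma magnus_free_group_mult: "magnus (u \<otimes>\<^bsub>free_group S\<^esub> v) = magnus u * magnus v"
  by (simp add: free_group_def magnus_mult)

lemma one_free_group: "\<one>\<^bsub>free_group S\<^esub> = []"
  by (simp add: free_group_def)

text \<open>
  An endomorphism of the free group acts on Magnus expansions by the substitution
  \<open>1 + X\<^sub>i \<mapsto> magnus (\<phi> x\<^sub>i)\<close>.
\<close>

theorem magnus_endomorphism:
  assumes S: "finite S" and \<phi>: "\<phi> \<in> hom (free_group S) (free_group S)"
    and w: "w \<in> carrier (free_group S)"
  shows "magnus (\<phi> w) = nc_subst S (\<lambda>i. magnus (\<phi> [(i, True)]) - 1) (magnus w)"
proof -
  define P where "P i = magnus (\<phi> [(i, True)]) - 1" for i
  interpret F: Group.group "free_group S" by (rule group_free_group)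
  interpret \<phi>: group_hom "free_group S" "free_group S" \<phi> by unfold_locales (fact \<phi>)
  have P: "nc_coeff (P i) [] = 0" for i by (simp add: P_def)
  have \<phi>_one: "\<phi> [] = []" using \<phi>.hom_one by (simp add: one_free_group)
  show ?thesis
    unfolding P_def[symmetric]
    using w
  proof (induction w)
    case Nil
    show ?case by (simp add: \<phi>_one nc_subst_one)
  next
    case (Cons a w)
    note aw = free_group_Cons[OF Cons.prems]
    have IH: "magnus (\<phi> w) = nc_subst S P (magnus w)" by (rule Cons.IH[OF aw(1)])
    have \<phi>_aw: "magnus (\<phi> (a # w)) = magnus (\<phi> [a]) * magnus (\<phi> w)"
      using aw by (metis \<phi>.hom_mult magnus_free_group_mult)
    show ?case
    proof (cases "snd a")
      case True
      then have "a = (fst a, True)" by (simp add: prod_eq_iff)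
      then have "1 + P (fst a) = magnus (\<phi> [a])" by (simp add: P_def)
      then show ?thesis
        using True \<phi>_aw IH nc_subst_var_mult[where P = P, OF S aw(3) P, of "magnus w"]
        by (simp add: magnus_letter_def)
    next
      case False
      let ?b = "(fst a, True)"
      have b: "[?b] \<in> carrier (free_group S)" using aw(3) by (simp add: free_group_def reduced_def)
      have ab: "[a] \<otimes>\<^bsub>free_group S\<^esub> [?b] = []"
        using False by (simp add: free_group_def inv_letter_def prod_eq_iff)
      have inv: "magnus (\<phi> [a]) * magnus (\<phi> [?b]) = 1"
        using aw(2) b ab \<phi>_one by (metis \<phi>.hom_mult magnus.simps(1) magnus_free_group_mult)
      \<comment> \<open>An inverse letter is moved to the other side, where it becomes a factor \<open>1 + X\<^sub>i\<close>.\<close>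
      have "(1 + nc_var (fst a)) * magnus (a # w) = magnus w"
        using False by (simp add: magnus_letter_def var_mult_geometric flip: mult.assoc)
      then have "magnus (\<phi> w) = magnus (\<phi> [?b]) * nc_subst S P (magnus (a # w))"
        using IH nc_subst_var_mult[where P = P, OF S aw(3) P, of "magnus (a # w)"] by (simp add: P_def del: magnus.simps)
      then show ?thesis
        unfolding \<phi>_aw by (simp add: inv flip: mult.assoc)
    qed
  qed
qed

section \<open>Dimension subgroups\<close>

text \<open>
  The words whose expansion is \<open>1\<close> up to terms of degree at least \<open>k\<close>; their terms of degree \<open>k\<close> form
  the leading form. It is additive and equivariant, and an element on which it vanishes lies one step
  deeper in the filtration.
\<close>

definition in_dimension_subgroup :: "nat \<Rightarrow> ('a \<times> bool) list \<Rightarrow> bool" where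
  "in_dimension_subgroup k u \<longleftrightarrow> (\<forall>v. v \<noteq> [] \<longrightarrow> length v < k \<longrightarrow> nc_coeff (magnus u) v = 0)"

definition leading_form :: "nat \<Rightarrow> ('a \<times> bool) list \<Rightarrow> 'a nc_series" where
  "leading_form k u = homogeneous_part k (magnus u)"

lemma in_dimension_subgroup_Nil: "in_dimension_subgroup k []"
  by (simp add: in_dimension_subgroup_def)

lemma leading_form_Nil: "k > 0 \<Longrightarrow> leading_form k [] = 0"
  by (rule nc_series_eqI) (simp add: leading_form_def)

lemma in_dimension_subgroup_Suc:
  "in_dimension_subgroup k u \<Longrightarrow> leading_form k u = 0 \<Longrightarrow> in_dimension_subgroup (Suc k) u"
  unfolding in_dimension_subgroup_def leading_form_def
  by (metis less_antisym nc_coeff_homogeneous_part nc_coeff_simps(1))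

lemma magnus_mult_low_degree:
  assumes u: "in_dimension_subgroup k u" "in_dimension_subgroup k v"
    and w: "w \<noteq> []" "length w \<le> k"
  shows "nc_coeff (magnus u * magnus v) w = nc_coeff (magnus u) w + nc_coeff (magnus v) w"
proof -
  have zero: "nc_coeff (magnus u) (take e w) * nc_coeff (magnus v) (drop e w) = 0"
    if "0 < e" "e < length w" for e
  proof -
    have "take e w \<noteq> []" "length (take e w) < k" using that w by auto
    then show ?thesis using u(1) by (simp add: in_dimension_subgroup_def)
  qed
  have "{..length w} = insert 0 (insert (length w) {0<..<length w})"
    by auto
  then have "nc_coeff (magnus u * magnus v) w = nc_coeff (magnus v) w + nc_coeff (magnus u) w
      + (\<Sum>e\<in>{0<..<length w}. nc_coeff (magnus u) (take e w) * nc_coeff (magnus v) (drop e w))"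
    using w(1) by (simp add: nc_coeff_mult)
  moreover have "(\<Sum>e\<in>{0<..<length w}. nc_coeff (magnus u) (take e w) * nc_coeff (magnus v) (drop e w)) = 0"
    by (intro sum.neutral ballI zero) auto
  ultimately show ?thesis by simp
qed

lemma dimension_subgroup_mult:
  assumes "in_dimension_subgroup k u" "in_dimension_subgroup k v" "k > 0"
  shows "in_dimension_subgroup k (u \<otimes>\<^bsub>free_group S\<^esub> v)"
    and "leading_form k (u \<otimes>\<^bsub>free_group S\<^esub> v) = leading_form k u + leading_form k v"
proof -
  note low = magnus_mult_low_degree[OF assms(1,2)]
  show "in_dimension_subgroup k (u \<otimes>\<^bsub>free_group S\<^esub> v)"
    using assms(1,2) low by (auto simp: in_dimension_subgroup_def magnus_free_group_mult)
  show "leading_form k (u \<otimes>\<^bsub>free_group S\<^esub> v) = leading_form k u + leading_form k v"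
    using low assms(3) by (intro nc_series_eqI) (auto simp: leading_form_def magnus_free_group_mult)
qed

definition abelianized_matrix :: "(('a \<times> bool) list \<Rightarrow> ('a \<times> bool) list) \<Rightarrow> 'a \<Rightarrow> 'a \<Rightarrow> int" where
  "abelianized_matrix \<phi> i j = nc_coeff (magnus (\<phi> [(i, True)])) [j]"

lemma endomorphism_leading_form:
  assumes S: "finite S" and \<phi>: "\<phi> \<in> hom (free_group S) (free_group S)"
    and u: "u \<in> carrier (free_group S)" "in_dimension_subgroup k u" and k: "k > 0"
  shows "in_dimension_subgroup k (\<phi> u)"
    and "leading_form k (\<phi> u) = tensor_map S (abelianized_matrix \<phi>) (leading_form k u)"
proof -
  define P where "P = (\<lambda>i. magnus (\<phi> [(i, True)]) - 1)"
  define r where "r = magnus u - 1"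
  have M: "abelianized_matrix \<phi> = (\<lambda>i j. nc_coeff (P i) [j])"
    by (simp add: abelianized_matrix_def P_def fun_eq_iff)
  have r: "nc_coeff r v = 0" if "length v < k" for v
    using that u(2) by (auto simp: r_def in_dimension_subgroup_def)
  have "magnus (\<phi> u) = nc_subst S P (1 + r)"
    using magnus_endomorphism[OF S \<phi> u(1)] by (simp add: P_def r_def)
  then have image: "magnus (\<phi> u) = 1 + nc_subst S P r"
    by (simp add: nc_subst_add nc_subst_one)
  have low: "nc_coeff (magnus (\<phi> u)) w = tensor_coeff S (abelianized_matrix \<phi>) w r"
    if "w \<noteq> []" "length w \<le> k" for w
    using that subst_leading_coeff[of k r w S P] r by (simp add: image M)
  have "tensor_coeff S (abelianized_matrix \<phi>) w r = 0" if "length w < k" for w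
    using tensor_coeff_cong[of w r 0] r that by (simp add: tensor_coeff_zero)
  then show "in_dimension_subgroup k (\<phi> u)"
    using low by (simp add: in_dimension_subgroup_def)
  have "tensor_coeff S (abelianized_matrix \<phi>) w r = tensor_coeff S (abelianized_matrix \<phi>) w (magnus u)"
    if "w \<noteq> []" for w
    using that by (intro tensor_coeff_cong) (auto simp: r_def)
  then show "leading_form k (\<phi> u) = tensor_map S (abelianized_matrix \<phi>) (leading_form k u)"
    using low k unfolding leading_form_def tensor_map_homogeneous_part
    by (intro nc_series_eqI) auto
qed

lemma endomorphism_funpow_leading_form:
  assumes S: "finite S" and \<phi>: "\<phi> \<in> hom (free_group S) (free_group S)"
    and u: "u \<in> carrier (free_group S)" "in_dimension_subgroup k u" and k: "k > 0"
  shows "(\<phi> ^^ c) u \<in> carrier (free_group S) \<and> in_dimension_subgroup k ((\<phi> ^^ c) u)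
    \<and> leading_form k ((\<phi> ^^ c) u) = (tensor_map S (abelianized_matrix \<phi>) ^^ c) (leading_form k u)"
proof (induction c)
  case (Suc c)
  then show ?case
    using endomorphism_leading_form[OF S \<phi> _ _ k] hom_in_carrier[OF \<phi>] by auto
qed (use u in simp)

lemma abelianized_matrix_outside:
  assumes "\<phi> \<in> hom (free_group S) (free_group S)" "i \<in> S" "j \<notin> S"
  shows "abelianized_matrix \<phi> i j = 0"
proof -
  have "[(i, True)] \<in> carrier (free_group S)"
    using assms(2) by (simp add: free_group_def reduced_def)
  then have "\<phi> [(i, True)] \<in> carrier (free_group S)" by (rule hom_in_carrier[OF assms(1)])
  then show ?thesis
    using assms(3) unfolding abelianized_matrix_def
    by (intro nc_coeff_magnus_singleton_outside) (auto simp: free_group_def)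
qed

text \<open>
  The element \<open>r i\<close> is the product \<open>h \<cdot> \<psi> h \<cdots> \<psi>\<^bsup>i-1\<^esup> h\<close>. If \<open>h\<close> lies in the \<open>k\<close>-th dimension
  subgroup, then the leading form of this product is the orbit sum of the leading form of \<open>h\<close>, so the
  latter vanishes as soon as the product is trivial for some \<open>i > 0\<close>. Thus \<open>h\<close> lies in all dimension
  subgroups, and Magnus' theorem applies.
\<close>

theorem twisted_orbit_product_trivial:
  fixes h :: "('a \<times> bool) list"
  assumes S: "finite S" "card S \<le> N" and \<phi>: "\<phi> \<in> hom (free_group S) (free_group S)"
    and h: "h \<in> carrier (free_group S)"
  defines "\<psi> \<equiv> \<phi> ^^ fact (4 ^ (N * N))"
  assumes r: "r 0 = []" "\<And>i. r (Suc i) = h \<otimes>\<^bsub>free_group S\<^esub> \<psi> (r i)"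
    and p: "p > 0" "r p = []"
  shows "h = []"
proof -
  define T where "T = tensor_map S (abelianized_matrix \<phi>) ^^ fact (4 ^ (N * N))"
  interpret T: mod4_idempotent T
    unfolding T_def by (rule mod4_idempotent_tensor_power[OF S abelianized_matrix_outside[OF \<phi>]])
  interpret F: Group.group "free_group S" by (rule group_free_group)
  have "in_dimension_subgroup (Suc k) h" for k
  proof (induction k)
    case 0
    show ?case by (simp add: in_dimension_subgroup_def)
  next
    case (Suc k)
    let ?k = "Suc k" and ?f = "leading_form (Suc k) h"
    have "r i \<in> carrier (free_group S) \<and> in_dimension_subgroup ?k (r i)
        \<and> leading_form ?k (r i) = (\<Sum>j<i. (T ^^ j) ?f)" for i
    proof (induction i)
      case 0
      show ?case
        using F.one_closed by (simp add: r(1) one_free_group in_dimension_subgroup_Nil leading_form_Nil)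
    next
      case IH: (Suc i)
      have \<psi>: "\<psi> (r i) \<in> carrier (free_group S)" "in_dimension_subgroup ?k (\<psi> (r i))"
        "leading_form ?k (\<psi> (r i)) = T (leading_form ?k (r i))"
        using endomorphism_funpow_leading_form[OF S(1) \<phi>, of "r i" ?k "fact (4 ^ (N * N))"] IH
        by (simp_all add: \<psi>_def T_def)
      have "?f + T (\<Sum>j<i. (T ^^ j) ?f) = (\<Sum>j<Suc i. (T ^^ j) ?f)"
        unfolding sum.lessThan_Suc_shift T.T_sum by simp
      then show ?case
        using dimension_subgroup_mult[OF Suc \<psi>(2), of S] \<psi> h IH by (simp add: r(2))
    qed
    from this[of p] have "(\<Sum>j<p. (T ^^ j) ?f) = 0"
      using p(2) by (simp add: leading_form_Nil)
    then have "?f = 0" by (rule T.orbit_sum_zero[OF p(1)])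
    then show ?case by (rule in_dimension_subgroup_Suc[OF Suc])
  qed
  then have "nc_coeff (magnus h) v = nc_coeff 1 v" for v
    unfolding in_dimension_subgroup_def using lessI by (cases "v = []") auto
  then have "magnus h = 1" by (rule nc_series_eqI)
  then show ?thesis using h by (intro magnus_faithful) (simp add: free_group_def)
qed

section \<open>Additive functions and the abelianization\<close>

text \<open>
  The coefficients of degree 1 of the Magnus expansion are the exponent sums.
\<close>

lemma additive_free_group:
  fixes \<kappa> :: "('a \<times> bool) list \<Rightarrow> int"
  assumes S: "finite S"
    and add: "\<And>u v. u \<in> carrier (free_group S) \<Longrightarrow> v \<in> carrier (free_group S)
      \<Longrightarrow> \<kappa> (u \<otimes>\<^bsub>free_group S\<^esub> v) = \<kappa> u + \<kappa> v"
    and w: "w \<in> carrier (free_group S)"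
  shows "\<kappa> w = (\<Sum>i\<in>S. nc_coeff (magnus w) [i] * \<kappa> [(i, True)])"
  using w
proof (induction w)
  case Nil
  have "\<kappa> [] = 0" using add[OF Nil Nil] by (simp add: free_group_def)
  then show ?case by simp
next
  case (Cons a w)
  note aw = free_group_Cons[OF Cons.prems]
  let ?b = "(fst a, True)" and ?e = "if snd a then 1 else - 1 :: int"
  have b: "[?b] \<in> carrier (free_group S)" using aw(3) by (simp add: free_group_def reduced_def)
  have nil: "[] \<in> carrier (free_group S)" by (simp add: free_group_def)
  have "\<kappa> [] = 0" using add[OF nil nil] by (simp add: free_group_def)
  then have "\<kappa> [a] = ?e * \<kappa> [?b]"
  proof (cases "snd a")
    case True
    then have "a = ?b" by (simp add: prod_eq_iff)
    then show ?thesis using True by simp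
  next
    case False
    then have "[a] \<otimes>\<^bsub>free_group S\<^esub> [?b] = []"
      by (simp add: free_group_def inv_letter_def prod_eq_iff)
    then show ?thesis using False add[OF aw(2) b] \<open>\<kappa> [] = 0\<close> by simp
  qed
  then have "\<kappa> (a # w) = ?e * \<kappa> [?b] + \<kappa> w"
    using add[OF aw(2,1)] aw(4) by simp
  also have "?e * \<kappa> [?b] = (\<Sum>i\<in>S. if i = fst a then ?e * \<kappa> [(i, True)] else 0)"
    using S aw(3) by simp
  also have "\<dots> + \<kappa> w = (\<Sum>i\<in>S. nc_coeff (magnus (a # w)) [i] * \<kappa> [(i, True)])"
    unfolding Cons.IH[OF aw(1)] sum.distrib[symmetric]
    by (intro sum.cong refl)
      (simp add: nc_coeff_mult_singleton nc_coeff_magnus_letter_Nil nc_coeff_magnus_letter_singleton distrib_right)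
  finally show ?case .
qed

definition unit_vector :: "nat \<Rightarrow> nat \<Rightarrow> nat \<Rightarrow> int" where
  "unit_vector m i = (\<lambda>j\<in>{..<m}. if j = i then 1 else 0)"

lemma int_power_group_simps:
  "carrier (int_power_group m) = {..<m} \<rightarrow>\<^sub>E UNIV"
  "a \<otimes>\<^bsub>int_power_group m\<^esub> b = (\<lambda>i\<in>{..<m}. a i + b i)"
  "\<one>\<^bsub>int_power_group m\<^esub> = (\<lambda>i\<in>{..<m}. 0)"
  by (simp_all add: int_power_group_def)

lemma group_int_power_group: "Group.group (int_power_group m)"
  unfolding int_power_group_def by simp

lemma additive_int:
  fixes f :: "int \<Rightarrow> int"
  assumes "\<And>x y. f (x + y) = f x + f y"
  shows "f z = z * f 1"
proof -
  have zero: "f 0 = 0" using assms[of 0 0] by simp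
  have nat: "f (int k) = int k * f 1" for k
    by (induction k) (simp_all add: zero assms distrib_right)
  show ?thesis
  proof (cases z)
    case (nonneg k)
    then show ?thesis using nat by simp
  next
    case (neg k)
    then have "f z = - f (int (Suc k))" using assms[of z "int (Suc k)"] zero by simp
    then show ?thesis using nat[of "Suc k"] neg by (simp del: of_nat_Suc)
  qed
qed

lemma additive_int_power_group:
  fixes \<kappa> :: "(nat \<Rightarrow> int) \<Rightarrow> int"
  assumes add: "\<And>a b. a \<in> carrier (int_power_group m) \<Longrightarrow> b \<in> carrier (int_power_group m)
      \<Longrightarrow> \<kappa> (a \<otimes>\<^bsub>int_power_group m\<^esub> b) = \<kappa> a + \<kappa> b"
    and a: "a \<in> carrier (int_power_group m)"
  shows "\<kappa> a = (\<Sum>i<m. a i * \<kappa> (unit_vector m i))"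
proof -
  \<comment> \<open>The vector \<open>a\<close> is built up from \<open>t 0 = 0\<close> to \<open>t m = a\<close> by adding one coordinate at a time.\<close>
  define t where "t l = (\<lambda>j\<in>{..<m}. if j < l then a j else 0)" for l
  define s where "s l z = (\<lambda>j\<in>{..<m}. if j = l then z else 0)" for l :: nat and z :: int
  have s: "\<kappa> (s l z) = z * \<kappa> (unit_vector m l)" for l z
  proof -
    have "s l (x + y) = s l x \<otimes>\<^bsub>int_power_group m\<^esub> s l y" for x y
      by (auto simp: s_def int_power_group_simps restrict_def)
    then have "\<kappa> (s l (x + y)) = \<kappa> (s l x) + \<kappa> (s l y)" for x y
      using add[of "s l x" "s l y"] by (simp add: s_def int_power_group_simps)
    then have "\<kappa> (s l z) = z * \<kappa> (s l 1)" by (rule additive_int)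
    then show ?thesis by (simp add: s_def unit_vector_def)
  qed
  have "l \<le> m \<Longrightarrow> \<kappa> (t l) = (\<Sum>i<l. a i * \<kappa> (unit_vector m i))" for l
  proof (induction l)
    case 0
    have "t 0 = s 0 0" by (auto simp: s_def t_def)
    then show ?case using s[of 0 0] by simp
  next
    case (Suc l)
    have "t (Suc l) = t l \<otimes>\<^bsub>int_power_group m\<^esub> s l (a l)"
      by (auto simp: s_def t_def int_power_group_simps restrict_def)
    then have "\<kappa> (t (Suc l)) = \<kappa> (t l) + \<kappa> (s l (a l))"
      using add[of "t l" "s l (a l)"] by (simp add: s_def t_def int_power_group_simps)
    then show ?case using Suc s by simp
  qed
  moreover have "t m = a"
    using a by (auto simp: t_def int_power_group_simps fun_eq_iff PiE_def extensional_def)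
  ultimately show ?thesis by (metis order_refl)
qed

text \<open>
  Coordinates on the abelianization \<open>\<int>\<^bsup>m+n\<^esup>\<close>: the first \<open>m\<close> come from \<open>\<int>\<^sup>m\<close>, the others are the exponent
  sums of the word. As a series, the class of an element is the linear form with these coefficients,
  so that the abelianization is covered by the results on tensor powers, in degree 1.
\<close>

definition abelian_coord :: "nat \<Rightarrow> nat \<Rightarrow> (nat \<Rightarrow> int) \<times> (nat \<times> bool) list \<Rightarrow> nat \<Rightarrow> int" where
  "abelian_coord m n x j =
    (if j < m then fst x j else if j < m + n then nc_coeff (magnus (snd x)) [j - m] else 0)"

definition abelian_generator :: "nat \<Rightarrow> nat \<Rightarrow> (nat \<Rightarrow> int) \<times> (nat \<times> bool) list" where
  "abelian_generator m i =
    (if i < m then (unit_vector m i, []) else (\<one>\<^bsub>int_power_group m\<^esub>, [(i - m, True)]))"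

definition abelian_class :: "nat \<Rightarrow> nat \<Rightarrow> (nat \<Rightarrow> int) \<times> (nat \<times> bool) list \<Rightarrow> nat nc_series" where
  "abelian_class m n x = Nc_Series (\<lambda>w. if length w = 1 then abelian_coord m n x (hd w) else 0)"

lemma free_times_free_abelian_simps:
  "carrier (free_times_free_abelian m n) = carrier (int_power_group m) \<times> carrier (free_group {..<n})"
  "(a, u) \<otimes>\<^bsub>free_times_free_abelian m n\<^esub> (b, v)
    = (a \<otimes>\<^bsub>int_power_group m\<^esub> b, u \<otimes>\<^bsub>free_group {..<n}\<^esub> v)"
  "\<one>\<^bsub>free_times_free_abelian m n\<^esub> = (\<one>\<^bsub>int_power_group m\<^esub>, [])"
  by (simp_all add: free_times_free_abelian_def one_free_group)

lemma abelian_coord_mult: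
  "abelian_coord m n (x \<otimes>\<^bsub>free_times_free_abelian m n\<^esub> y) j = abelian_coord m n x j + abelian_coord m n y j"
  by (cases x; cases y)
    (simp add: abelian_coord_def free_times_free_abelian_simps int_power_group_simps
      magnus_free_group_mult nc_coeff_mult_singleton)

lemma additive_free_times_free_abelian:
  fixes \<chi> :: "(nat \<Rightarrow> int) \<times> (nat \<times> bool) list \<Rightarrow> int"
  defines "G m n \<equiv> free_times_free_abelian m n"
  assumes add: "\<And>x y. x \<in> carrier (G m n) \<Longrightarrow> y \<in> carrier (G m n) \<Longrightarrow> \<chi> (x \<otimes>\<^bsub>G m n\<^esub> y) = \<chi> x + \<chi> y"
    and x: "x \<in> carrier (G m n)"
  shows "\<chi> x = (\<Sum>i<m + n. abelian_coord m n x i * \<chi> (abelian_generator m i))"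
proof -
  interpret Z: Group.group "int_power_group m" by (rule group_int_power_group)
  interpret F: Group.group "free_group {..<n}" by (rule group_free_group)
  obtain a u where au: "x = (a, u)" "a \<in> carrier (int_power_group m)" "u \<in> carrier (free_group {..<n})"
    using x by (auto simp: G_def free_times_free_abelian_simps)
  note F_one = F.one_closed[unfolded one_free_group]
  let ?one = "\<one>\<^bsub>int_power_group m\<^esub>"
  have F_l_one: "[] \<otimes>\<^bsub>free_group {..<n}\<^esub> u = u"
    using au F.l_one by (metis one_free_group)
  have "x = (a, []) \<otimes>\<^bsub>G m n\<^esub> (?one, u)"
    using au F_l_one by (simp add: G_def free_times_free_abelian_simps)
  then have "\<chi> x = \<chi> (a, []) + \<chi> (?one, u)"
    using add[of "(a, [])" "(?one, u)"] au F_one F_l_one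
    by (simp add: G_def free_times_free_abelian_simps)
  also have "\<chi> (a, []) = (\<Sum>i<m. a i * \<chi> (unit_vector m i, []))"
  proof (rule additive_int_power_group[of m "\<lambda>a. \<chi> (a, [])"])
    fix a b assume "a \<in> carrier (int_power_group m)" "b \<in> carrier (int_power_group m)"
    then show "\<chi> (a \<otimes>\<^bsub>int_power_group m\<^esub> b, []) = \<chi> (a, []) + \<chi> (b, [])"
      using add[of "(a, [])" "(b, [])"] F_one
      by (simp add: G_def free_times_free_abelian_simps) (simp add: free_group_def)
  qed (fact au)
  also have "\<chi> (?one, u) = (\<Sum>i<n. nc_coeff (magnus u) [i] * \<chi> (?one, [(i, True)]))"
  proof (rule additive_free_group[of "{..<n}" "\<lambda>u. \<chi> (?one, u)"])
    fix u v assume "u \<in> carrier (free_group {..<n})" "v \<in> carrier (free_group {..<n})"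
    then show "\<chi> (?one, u \<otimes>\<^bsub>free_group {..<n}\<^esub> v) = \<chi> (?one, u) + \<chi> (?one, v)"
      using add[of "(?one, u)" "(?one, v)"]
      by (simp add: G_def free_times_free_abelian_simps)
  qed (use au in simp_all)
  also have "(\<Sum>i<m. a i * \<chi> (unit_vector m i, [])) + (\<Sum>i<n. nc_coeff (magnus u) [i] * \<chi> (?one, [(i, True)]))
      = (\<Sum>i<m + n. abelian_coord m n x i * \<chi> (abelian_generator m i))"
  proof -
    have "sum f {..<m + n} = sum f {..<m} + (\<Sum>i<n. f (m + i))" for f :: "nat \<Rightarrow> int"
      by (induction n) simp_all
    then show ?thesis by (simp add: au abelian_coord_def abelian_generator_def)
  qed
  finally show ?thesis .
qed

lemma tensor_map_degree_one:
  assumes "\<And>w. length w \<noteq> 1 \<Longrightarrow> nc_coeff f w = 0"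
  shows "nc_coeff (tensor_map S M f) w
    = (if length w = 1 then \<Sum>i\<in>S. M i (hd w) * nc_coeff f [i] else 0)"
proof (cases "length w = 1")
  case True
  then obtain j where "w = [j]" by (cases w) auto
  then show ?thesis by simp
next
  case False
  then have "tensor_coeff S M w f = tensor_coeff S M w 0"
    using assms by (intro tensor_coeff_cong) auto
  then show ?thesis using False by (simp add: tensor_coeff_zero)
qed

lemma abelian_class_endomorphism:
  assumes \<Psi>: "\<Psi> \<in> hom (free_times_free_abelian m n) (free_times_free_abelian m n)"
    and x: "x \<in> carrier (free_times_free_abelian m n)"
  shows "abelian_class m n (\<Psi> x)
    = tensor_map {..<m + n} (\<lambda>i. abelian_coord m n (\<Psi> (abelian_generator m i))) (abelian_class m n x)"
proof (rule nc_series_eqI)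
  fix w
  have "abelian_coord m n (\<Psi> x) j
      = (\<Sum>i<m + n. abelian_coord m n x i * abelian_coord m n (\<Psi> (abelian_generator m i)) j)" for j
    using x by (intro additive_free_times_free_abelian)
      (simp_all add: hom_mult[OF \<Psi>] abelian_coord_mult)
  then show "nc_coeff (abelian_class m n (\<Psi> x)) w = nc_coeff (tensor_map {..<m + n}
      (\<lambda>i. abelian_coord m n (\<Psi> (abelian_generator m i))) (abelian_class m n x)) w"
    by (subst tensor_map_degree_one) (auto simp: abelian_class_def mult.commute)
qed

section \<open>Periodic points of endomorphisms of \<open>\<int>\<^sup>m \<times> F\<^sub>n\<close>\<close>

lemma funpow_hom_closed:
  "\<Psi> \<in> hom G G \<Longrightarrow> x \<in> carrier G \<Longrightarrow> (\<Psi> ^^ i) x \<in> carrier G"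
  by (induction i) (auto simp: hom_in_carrier)

lemma funpow_hom_mult:
  "\<Psi> \<in> hom G G \<Longrightarrow> x \<in> carrier G \<Longrightarrow> y \<in> carrier G
    \<Longrightarrow> (\<Psi> ^^ i) (x \<otimes>\<^bsub>G\<^esub> y) = (\<Psi> ^^ i) x \<otimes>\<^bsub>G\<^esub> (\<Psi> ^^ i) y"
  by (induction i) (auto simp: hom_mult funpow_hom_closed)

text \<open>
  The class of \<open>x\<close> in the abelianization is periodic, hence fixed by \<open>\<psi>\<close>, the power of \<open>\<Psi>\<close> considered
  here. Therefore \<open>\<psi> x = x h\<close> with \<open>h = (0, v)\<close>, where all exponent sums of \<open>v\<close> vanish. On such elements
  \<open>\<Psi>\<close> acts as an endomorphism \<open>\<phi>\<close> of the free factor, even though it need not preserve that factor: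
  the component in \<open>\<int>\<^sup>m\<close> of the image depends on the exponent sums only. Since \<open>\<psi>\<^bsup>i\<^esup> x\<close> is \<open>x\<close> times the
  product of the first \<open>i\<close> elements of the orbit of \<open>h\<close>, periodicity of \<open>x\<close> makes such a product
  trivial, and then \<open>h\<close> is trivial.
\<close>

theorem periodic_point_fixed:
  fixes m n :: nat
  defines "G \<equiv> free_times_free_abelian m n"
  assumes \<Psi>: "\<Psi> \<in> hom G G" and x: "x \<in> carrier G" and p: "p > 0" "(\<Psi> ^^ p) x = x"
  shows "(\<Psi> ^^ fact (4 ^ ((m + n) * (m + n)))) x = x"
proof -
  define c where "c = (fact (4 ^ ((m + n) * (m + n))) :: nat)"
  define \<psi> where "\<psi> = \<Psi> ^^ c"
  let ?F = "free_group {..<n}" and ?Z = "int_power_group m" and ?one = "\<one>\<^bsub>int_power_group m\<^esub>"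
  interpret G: Group.group G unfolding G_def by (rule group_free_times_free_abelian)
  interpret Z: Group.group ?Z by (rule group_int_power_group)
  interpret F: Group.group ?F by (rule group_free_group)
  note G_simps = free_times_free_abelian_simps[of m n, folded G_def]
  have \<psi>_closed: "\<psi> y \<in> carrier G" if "y \<in> carrier G" for y
    unfolding \<psi>_def by (rule funpow_hom_closed[OF \<Psi> that])
  have \<psi>_mult: "\<psi> (y \<otimes>\<^bsub>G\<^esub> z) = \<psi> y \<otimes>\<^bsub>G\<^esub> \<psi> z" if "y \<in> carrier G" "z \<in> carrier G" for y z
    unfolding \<psi>_def by (rule funpow_hom_mult[OF \<Psi> that])
  have periodic: "(\<psi> ^^ p) x = x"
  proof -
    have "((\<Psi> ^^ p) ^^ c) x = x" using p(2) by (induction c) auto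
    then show ?thesis unfolding \<psi>_def by (metis funpow_mult mult.commute)
  qed

  define B where "B i = abelian_coord m n (\<Psi> (abelian_generator m i))" for i
  define T where "T = tensor_map {..<m + n} B"
  interpret T: mod4_idempotent "T ^^ c"
    unfolding T_def c_def
    by (rule mod4_idempotent_tensor_power) (auto simp: B_def abelian_coord_def)
  have "abelian_class m n (\<Psi> y) = T (abelian_class m n y)" if "y \<in> carrier G" for y
    using abelian_class_endomorphism[of \<Psi> m n y] \<Psi> that by (simp add: T_def B_def[abs_def] G_def)
  then have "abelian_class m n ((\<Psi> ^^ i) x) = (T ^^ i) (abelian_class m n x)" for i
    by (induction i) (use \<Psi> x in \<open>auto simp: funpow_hom_closed\<close>)
  then have class_\<psi>: "abelian_class m n ((\<psi> ^^ i) x) = ((T ^^ c) ^^ i) (abelian_class m n x)" for i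
    by (simp add: \<psi>_def funpow_mult)
  then have "((T ^^ c) ^^ p) (abelian_class m n x) = abelian_class m n x"
    using periodic by metis
  then have "(T ^^ c) (abelian_class m n x) = abelian_class m n x"
    by (rule T.periodic_imp_fixed[OF p(1)])
  then have class_fixed: "abelian_class m n (\<psi> x) = abelian_class m n x"
    using class_\<psi>[of 1] by simp
  have coord_fixed: "abelian_coord m n (\<psi> x) j = abelian_coord m n x j" for j
    using arg_cong[OF class_fixed, of "\<lambda>f. nc_coeff f [j]"] by (simp add: abelian_class_def)

  have kernel: "\<exists>v. y = (?one, v) \<and> v \<in> carrier ?F \<and> in_dimension_subgroup 2 v"
    if y: "y \<in> carrier G" "\<And>j. abelian_coord m n y j = 0" for y
  proof -
    obtain a v where av: "y = (a, v)" "a \<in> carrier ?Z" "v \<in> carrier ?F"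
      using y(1) by (auto simp: G_simps)
    have "a = ?one"
    proof
      fix j
      show "a j = ?one j"
        using y(2)[of j] av by (cases "j < m")
          (auto simp: int_power_group_simps abelian_coord_def PiE_def extensional_def)
    qed
    moreover have "nc_coeff (magnus v) [j] = 0" for j
    proof (cases "j < n")
      case True
      then show ?thesis using y(2)[of "m + j"] by (simp add: av abelian_coord_def)
    next
      case False
      then show ?thesis
        using av(3) by (intro nc_coeff_magnus_singleton_outside[of v "{..<n}"]) (auto simp: free_group_def)
    qed
    then have "in_dimension_subgroup 2 v"
      unfolding in_dimension_subgroup_def
      by (metis One_nat_def length_0_conv length_Suc_conv less_2_cases)
    ultimately show ?thesis using av by blast
  qed

  \<comment> \<open>The displacement of \<open>x\<close> under \<open>\<psi>\<close>.\<close>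
  define h where "h = inv\<^bsub>G\<^esub> x \<otimes>\<^bsub>G\<^esub> \<psi> x"
  have h_closed: "h \<in> carrier G" and x_h: "x \<otimes>\<^bsub>G\<^esub> h = \<psi> x"
    using x \<psi>_closed[OF x] by (simp_all add: h_def flip: G.m_assoc)
  have "abelian_coord m n h j = 0" for j
    using coord_fixed[of j] x_h abelian_coord_mult[of m n x h j] by (simp add: G_def)
  then obtain v where v: "h = (?one, v)" "v \<in> carrier ?F" "in_dimension_subgroup 2 v"
    using kernel[OF h_closed] by blast

  define \<phi> where "\<phi> u = snd (\<Psi> (?one, u))" for u
  have \<phi>: "\<phi> \<in> hom ?F ?F"
  proof (rule homI)
    fix u w assume uw: "u \<in> carrier ?F" "w \<in> carrier ?F"
    then have in_G: "(?one, u) \<in> carrier G" "(?one, w) \<in> carrier G" by (simp_all add: G_simps)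
    then show "\<phi> u \<in> carrier ?F"
      using hom_in_carrier[OF \<Psi>] by (auto simp: \<phi>_def G_simps mem_Times_iff)
    have "\<Psi> (?one, u \<otimes>\<^bsub>?F\<^esub> w) = \<Psi> (?one, u) \<otimes>\<^bsub>G\<^esub> \<Psi> (?one, w)"
      using hom_mult[OF \<Psi> in_G] by (simp add: G_simps)
    then show "\<phi> (u \<otimes>\<^bsub>?F\<^esub> w) = \<phi> u \<otimes>\<^bsub>?F\<^esub> \<phi> w"
      unfolding \<phi>_def by (cases "\<Psi> (?one, u)"; cases "\<Psi> (?one, w)") (simp add: G_simps)
  qed
  have \<Psi>_commutator: "\<Psi> (?one, u) = (?one, \<phi> u)"
    if u: "u \<in> carrier ?F" "in_dimension_subgroup 2 u" for u
  proof -
    have in_G: "(?one, u) \<in> carrier G" using u by (simp add: G_simps)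
    have "nc_coeff (magnus u) [j] = 0" for j
      using u(2) by (simp add: in_dimension_subgroup_def)
    then have "abelian_coord m n (?one, u) i = 0" for i
      by (simp add: abelian_coord_def int_power_group_simps)
    then have "abelian_class m n (?one, u) = 0"
      by (intro nc_series_eqI) (simp add: abelian_class_def)
    then have "abelian_class m n (\<Psi> (?one, u)) = 0"
      using abelian_class_endomorphism[of \<Psi> m n] \<Psi> in_G
      by (intro nc_series_eqI) (simp add: G_def tensor_coeff_zero)
    then have "nc_coeff (abelian_class m n (\<Psi> (?one, u))) [j] = 0" for j by simp
    then have "abelian_coord m n (\<Psi> (?one, u)) j = 0" for j by (simp add: abelian_class_def)
    then show ?thesis
      using kernel[OF hom_in_carrier[OF \<Psi> in_G]] by (auto simp: \<phi>_def)
  qed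
  have \<psi>_commutator: "\<psi> (?one, u) = (?one, (\<phi> ^^ c) u)"
    if u: "u \<in> carrier ?F" "in_dimension_subgroup 2 u" for u
  proof -
    have "(\<Psi> ^^ i) (?one, u) = (?one, (\<phi> ^^ i) u)" for i
      using endomorphism_funpow_leading_form[OF _ \<phi> u]
      by (induction i) (auto simp: \<Psi>_commutator)
    then show ?thesis by (simp add: \<psi>_def)
  qed

  define r where "r i = ((\<lambda>u. v \<otimes>\<^bsub>?F\<^esub> (\<phi> ^^ c) u) ^^ i) []" for i
  have r: "r i \<in> carrier ?F \<and> in_dimension_subgroup 2 (r i) \<and> (\<psi> ^^ i) x = x \<otimes>\<^bsub>G\<^esub> (?one, r i)" for i
  proof (induction i)
    case 0
    then show ?case
      using F.one_closed G.r_one[OF x] by (simp add: r_def one_free_group in_dimension_subgroup_Nil G_simps)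
  next
    case (Suc i)
    have Suc_r: "r (Suc i) = v \<otimes>\<^bsub>?F\<^esub> (\<phi> ^^ c) (r i)" by (simp add: r_def)
    have step: "(\<phi> ^^ c) (r i) \<in> carrier ?F" "in_dimension_subgroup 2 ((\<phi> ^^ c) (r i))"
      using endomorphism_funpow_leading_form[OF _ \<phi>, of "r i" 2 c] Suc by auto
    have in_G: "(?one, r i) \<in> carrier G" "(?one, (\<phi> ^^ c) (r i)) \<in> carrier G"
      using Suc step by (simp_all add: G_simps)
    have "(\<psi> ^^ Suc i) x = \<psi> x \<otimes>\<^bsub>G\<^esub> \<psi> (?one, r i)"
      using Suc \<psi>_mult[OF x in_G(1)] by simp
    also have "\<dots> = x \<otimes>\<^bsub>G\<^esub> (h \<otimes>\<^bsub>G\<^esub> (?one, (\<phi> ^^ c) (r i)))"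
      using Suc \<psi>_commutator x h_closed in_G by (simp add: G.m_assoc flip: x_h)
    also have "h \<otimes>\<^bsub>G\<^esub> (?one, (\<phi> ^^ c) (r i)) = (?one, r (Suc i))"
      by (simp add: v(1) G_simps Suc_r)
    finally show ?case
      using dimension_subgroup_mult(1)[OF v(3) step(2), of "{..<n}"] v(2) step(1) by (simp add: Suc_r)
  qed
  have "x \<otimes>\<^bsub>G\<^esub> (?one, r p) = x \<otimes>\<^bsub>G\<^esub> \<one>\<^bsub>G\<^esub>"
    using r[of p] periodic x by simp
  moreover have "(?one, r p) \<in> carrier G" using r[of p] by (simp add: G_simps)
  ultimately have "(?one, r p) = \<one>\<^bsub>G\<^esub>"
    using x G.l_cancel G.one_closed by blast
  then have "r p = []" by (simp add: G_simps)
  then have "v = []"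
    using twisted_orbit_product_trivial[of "{..<n}" "m + n" \<phi> v r p] \<phi> v(2) p(1)
    by (simp add: r_def c_def)
  then have "h = \<one>\<^bsub>G\<^esub>" using v(1) by (simp add: G_simps)
  then show ?thesis using x_h x by (simp add: \<psi>_def c_def)
qed

section \<open>Computability of the exponent\<close>

text \<open>
  Composing recursive functions literally produces \<open>f (map (\<lambda>g. g xs) gs)\<close>, which agrees with the
  intended arithmetic expression only on tuples of the right length. Passing to functions up to
  agreement on such tuples makes the closure properties usable with ordinary notation.
\<close>

definition computes :: "nat \<Rightarrow> (nat list \<Rightarrow> nat) \<Rightarrow> bool" where
  "computes k F \<longleftrightarrow> (\<exists>f. recursive k f \<and> (\<forall>xs. length xs = k \<longrightarrow> f xs = F xs))"

lemma computes_cong: "computes k F \<Longrightarrow> (\<And>xs. length xs = k \<Longrightarrow> F xs = F' xs) \<Longrightarrow> computes k F'"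
  unfolding computes_def by metis

lemma computes_recursive: "recursive k f \<Longrightarrow> computes k f"
  unfolding computes_def by blast

lemma computes_compose1:
  assumes "computes 1 H" "computes k F"
  shows "computes k (\<lambda>xs. H [F xs])"
proof -
  obtain h f where h: "recursive 1 h" "\<And>xs. length xs = 1 \<Longrightarrow> h xs = H xs"
    and f: "recursive k f" "\<And>xs. length xs = k \<Longrightarrow> f xs = F xs"
    using assms unfolding computes_def by blast
  have "recursive k (\<lambda>xs. h (map (\<lambda>g. g xs) [f]))"
    by (rule recursive.comp) (simp_all add: h(1)[unfolded One_nat_def] f)
  from computes_recursive[OF this] show ?thesis
    by (rule computes_cong) (simp add: h f)
qed

lemma computes_compose2:
  assumes "computes 2 H" "computes k F" "computes k F'"
  shows "computes k (\<lambda>xs. H [F xs, F' xs])"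
proof -
  obtain h f f' where h: "recursive 2 h" "\<And>xs. length xs = 2 \<Longrightarrow> h xs = H xs"
    and f: "recursive k f" "\<And>xs. length xs = k \<Longrightarrow> f xs = F xs"
    and f': "recursive k f'" "\<And>xs. length xs = k \<Longrightarrow> f' xs = F' xs"
    using assms unfolding computes_def by blast
  have "recursive k (\<lambda>xs. h (map (\<lambda>g. g xs) [f, f']))"
    by (rule recursive.comp) (simp_all add: h(1)[unfolded numeral_2_eq_2] f f')
  from computes_recursive[OF this] show ?thesis
    by (rule computes_cong) (simp add: h f f')
qed

lemma computes_prim_rec:
  assumes "computes k F" "computes (Suc (Suc k)) H"
  shows "computes (Suc k) (\<lambda>xs. rec_nat (F (tl xs)) (\<lambda>y r. H (y # r # tl xs)) (hd xs))"
proof -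
  obtain f h where f: "recursive k f" "\<And>xs. length xs = k \<Longrightarrow> f xs = F xs"
    and h: "recursive (Suc (Suc k)) h" "\<And>xs. length xs = Suc (Suc k) \<Longrightarrow> h xs = H xs"
    using assms unfolding computes_def by blast
  have "rec_nat (f ys) (\<lambda>y r. h (y # r # ys)) z = rec_nat (F ys) (\<lambda>y r. H (y # r # ys)) z"
    if "length ys = k" for ys z
    using that by (induction z) (simp_all add: f h)
  with computes_recursive[OF recursive.prim_rec[OF f(1) h(1)]] show ?thesis
    by (auto elim!: computes_cong)
qed

lemma computes_proj: "i < k \<Longrightarrow> computes k (\<lambda>xs. xs ! i)"
  by (intro computes_recursive recursive.proj)

lemma computes_Suc: "computes k F \<Longrightarrow> computes k (\<lambda>xs. Suc (F xs))"
  using computes_compose1[OF computes_recursive[OF recursive.succ]] by simp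

lemma computes_one: "computes k (\<lambda>_. 1)"
  using computes_Suc[OF computes_recursive[OF recursive.zero]] by simp

lemma computes_add:
  assumes "computes k F" "computes k F'"
  shows "computes k (\<lambda>xs. F xs + F' xs)"
proof -
  have "computes (Suc 1) (\<lambda>xs. rec_nat (tl xs ! 0) (\<lambda>y r. Suc ((y # r # tl xs) ! 1)) (hd xs))"
    by (rule computes_prim_rec[of 1 "\<lambda>xs. xs ! 0"]) (simp_all add: computes_Suc computes_proj)
  moreover have "rec_nat b (\<lambda>y r. Suc r) a = a + b" for a b :: nat by (induction a) auto
  ultimately have "computes 2 (\<lambda>xs. hd xs + tl xs ! 0)" by (simp add: numeral_2_eq_2)
  from computes_compose2[OF this assms] show ?thesis by simp
qed

lemma computes_mult:
  assumes "computes k F" "computes k F'"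
  shows "computes k (\<lambda>xs. F xs * F' xs)"
proof -
  have "computes (Suc 1) (\<lambda>xs. rec_nat 0 (\<lambda>y r. (y # r # tl xs) ! 1 + (y # r # tl xs) ! 2) (hd xs))"
    by (rule computes_prim_rec[of 1 "\<lambda>xs. 0"])
      (simp_all add: computes_add computes_proj computes_recursive recursive.zero)
  moreover have "rec_nat 0 (\<lambda>y r. r + b) a = a * b" for a b :: nat by (induction a) auto
  ultimately have "computes 2 (\<lambda>xs. hd xs * tl xs ! 0)" by (simp add: numeral_2_eq_2)
  from computes_compose2[OF this assms] show ?thesis by simp
qed

lemma computes_fact:
  assumes "computes k F"
  shows "computes k (\<lambda>xs. fact (F xs))"
proof -
  have "computes (Suc 0) (\<lambda>xs. rec_nat 1 (\<lambda>y r. Suc ((y # r # tl xs) ! 0) * (y # r # tl xs) ! 1) (hd xs))"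
    by (rule computes_prim_rec[of 0 "\<lambda>xs. 1"])
      (simp_all only: computes_one, intro computes_mult computes_Suc computes_proj, simp_all)
  moreover have "rec_nat 1 (\<lambda>y r. Suc y * r) a = fact a" for a :: nat
    by (induction a) (simp_all only: nat.rec fact_0 fact_Suc of_nat_id)
  ultimately have "computes 1 (\<lambda>xs. fact (hd xs))" by simp
  from computes_compose1[OF this assms] show ?thesis by simp
qed

lemma computes_power4:
  assumes "computes k F"
  shows "computes k (\<lambda>xs. 4 ^ F xs)"
proof -
  have "computes (Suc 0) (\<lambda>xs. rec_nat 1 (\<lambda>y r. Suc (Suc (Suc 1)) * (y # r # tl xs) ! 1) (hd xs))"
    by (rule computes_prim_rec[of 0 "\<lambda>xs. 1"])
      (simp_all only: computes_one, intro computes_mult computes_Suc computes_proj computes_one, simp_all)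
  moreover have "rec_nat 1 (\<lambda>y r. Suc (Suc (Suc 1)) * r) a = 4 ^ a" for a :: nat
    by (induction a) simp_all
  ultimately have "computes 1 (\<lambda>xs. 4 ^ hd xs)" by simp
  from computes_compose1[OF this assms] show ?thesis by simp
qed

lemma computable_exponent: "computable2 (\<lambda>m n. fact (4 ^ ((m + n) * (m + n))))"
proof -
  have "computes 2 (\<lambda>xs. fact (4 ^ ((xs ! 0 + xs ! 1) * (xs ! 0 + xs ! 1))))"
    by (intro computes_fact computes_power4 computes_mult computes_add computes_proj) simp_all
  then obtain f where "recursive 2 f"
    "\<And>xs. length xs = 2 \<Longrightarrow> f xs = fact (4 ^ ((xs ! 0 + xs ! 1) * (xs ! 0 + xs ! 1)))"
    unfolding computes_def by blast
  then show ?thesis unfolding computable2_def by (intro exI[of _ f]) simp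
qed

section \<open>A uniform exponent for periodic points\<close>

theorem theorem4p3:
  shows "\<exists>C3 :: nat \<Rightarrow> nat \<Rightarrow> nat. computable2 C3 \<and>
    (\<forall>m n. C3 m n > 0 \<and>
      (\<forall>\<Psi> \<in> hom (free_times_free_abelian m n) (free_times_free_abelian m n).
        Per (free_times_free_abelian m n) \<Psi> =
        Fix (free_times_free_abelian m n) (\<Psi> ^^ C3 m n)))"
proof (intro exI conjI allI ballI)
  show "computable2 (\<lambda>m n. fact (4 ^ ((m + n) * (m + n))))"
    by (rule computable_exponent)
next
  fix m n :: nat
  show "(fact (4 ^ ((m + n) * (m + n))) :: nat) > 0" by (rule fact_gt_zero)
next
  fix m n :: nat and \<Psi>
  let ?G = "free_times_free_abelian m n" and ?c = "fact (4 ^ ((m + n) * (m + n))) :: nat"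
  assume \<Psi>: "\<Psi> \<in> hom ?G ?G"
  have "Fix ?G (\<Psi> ^^ p) \<subseteq> Fix ?G (\<Psi> ^^ ?c)" if "p \<ge> 1" for p
    using periodic_point_fixed[OF \<Psi>, of _ p] that by (auto simp: Fix_def)
  moreover have "?c \<in> {1..}" using fact_ge_1 by simp
  ultimately show "Per ?G \<Psi> = Fix ?G (\<Psi> ^^ ?c)"
    unfolding Per_def by blast
qed

end
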